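(* Let $M\subset H^2$ be a nontrivial (in particular nonzero) nearly invariant subspace for $S^*$ of the form $M=gK_\theta$, where $\theta$ is an inner function, $g\in M$ is the element of unit norm which has positive value at the origin and is orthogonal to all elements of $M$ vanishing at the origin, and multiplication by $g$ is everywhere defined and isometric from $K_\theta$ into $H^2$. Then $M$ is almost-invariant for $S$ with defect $1$. Moreover, if $\theta$ is not rational, then $M$ is an almost-invariant half-space for $S$ with defect $1$.
   Context: $\mathbb{D}$ is the open unit disc, $\mathbb{T}$ the unit circle, and $H^2$ is the Hardy space of analytic functions on $\mathbb{D}$, identified via boundary values with a closed subspace of $L^2(\mathbb{T})$ (normalized Lebesgue measure). $S$ is the unilateral shift $Sf(z)=zf(z)$ on $H^2$ and $S^*f(z)=(f(z)-f(0))/z$ is its adjoint. "Subspace" means closed linear subspace. For an inner function $\theta$, $K_\theta=(\theta H^2)^\perp=H^2\ominus\theta H^2$. A subspace $M\subset H^2$ is nearly invariant for $S^*$ if $S^*f\in M$ whenever $f\in M$ and $f(0)=0$. A subspace $M$ is almost-invariant for an operator $T$ if there is a finite-dimensional subspace $F$ with $TM\subset M+F$; the smallest possible dimension of such an $F$ is called the defect of $M$. A half-space is a subspace of infinite dimension and infinite codimension. *)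

theory Defs
  imports
    "HOL-Complex_Analysis.Complex_Analysis"
    "HOL-Computational_Algebra.Polynomial"
    "HOL-Library.Function_Algebras"
begin

section \<open>Complex-valued functions as a complex vector space\<close>

definition cscale :: "complex \<Rightarrow> (complex \<Rightarrow> complex) \<Rightarrow> complex \<Rightarrow> complex" where
  "cscale c f = (\<lambda>z. c * f z)"

interpretation cfun: vector_space cscale
  by unfold_locales (auto simp: cscale_def fun_eq_iff algebra_simps)

text \<open>\<open>cfun.dim\<close> is \<open>0\<close> on infinite-dimensional spaces, so finite dimension is a separate
  predicate.\<close>

definition finite_dimensional :: "(complex \<Rightarrow> complex) set \<Rightarrow> bool" where
  "finite_dimensional F \<longleftrightarrow> (\<exists>B. finite B \<and> F = cfun.span B)"

section \<open>The Hardy space\<close>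

abbreviation unit_disc :: "complex set" where
  "unit_disc \<equiv> ball 0 1"

text \<open>Normalized Lebesgue measure on the unit circle, as a Borel measure on the plane that is
  carried by the circle.\<close>

definition circle_measure :: "complex measure" where
  "circle_measure = distr (uniform_measure lborel {0..2 * pi}) borel cis"

text \<open>Functions on the disc are extended by \<open>0\<close> to the whole plane, so that equality of
  Hardy space elements is equality of HOL functions.\<close>

definition hardy2 :: "(complex \<Rightarrow> complex) set" where
  "hardy2 = {f. f holomorphic_on unit_disc \<and> (\<forall>z. z \<notin> unit_disc \<longrightarrow> f z = 0) \<and>
     (\<exists>C. \<forall>r\<in>{0..<1}. (LINT \<zeta>|circle_measure. (cmod (f (of_real r * \<zeta>)))\<^sup>2) \<le> C)}"

text \<open>The boundary values of \<open>f\<close> are the limit in \<open>L\<^sup>2\<close> of the circle of its dilates; they are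
  determined almost everywhere, which makes the inner product below independent of the choice.\<close>

definition has_boundary_values ::
    "(complex \<Rightarrow> complex) \<Rightarrow> (complex \<Rightarrow> complex) \<Rightarrow> bool" where
  "has_boundary_values f F \<longleftrightarrow>
     F \<in> borel_measurable circle_measure \<and>
     integrable circle_measure (\<lambda>\<zeta>. (cmod (F \<zeta>))\<^sup>2) \<and>
     ((\<lambda>r. LINT \<zeta>|circle_measure. (cmod (f (of_real r * \<zeta>) - F \<zeta>))\<^sup>2) \<longlongrightarrow> 0) (at_left 1)"

definition boundary :: "(complex \<Rightarrow> complex) \<Rightarrow> complex \<Rightarrow> complex" where
  "boundary f = (SOME F. has_boundary_values f F)"

definition h2_inner :: "(complex \<Rightarrow> complex) \<Rightarrow> (complex \<Rightarrow> complex) \<Rightarrow> complex" where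
  "h2_inner f g = (LINT \<zeta>|circle_measure. boundary f \<zeta> * cnj (boundary g \<zeta>))"

definition h2_norm :: "(complex \<Rightarrow> complex) \<Rightarrow> real" where
  "h2_norm f = sqrt (Re (h2_inner f f))"

definition h2_subspace :: "(complex \<Rightarrow> complex) set \<Rightarrow> bool" where
  "h2_subspace M \<longleftrightarrow> M \<subseteq> hardy2 \<and> cfun.subspace M \<and>
     (\<forall>u f. (\<forall>n. u n \<in> M) \<and> f \<in> hardy2 \<and> (\<lambda>n. h2_norm (u n - f)) \<longlonglongrightarrow> 0 \<longrightarrow> f \<in> M)"

section \<open>Shifts, inner functions and model spaces\<close>

definition shift :: "(complex \<Rightarrow> complex) \<Rightarrow> complex \<Rightarrow> complex" where
  "shift f = (\<lambda>z. z * f z)"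

text \<open>At the origin the difference quotient is given its removable value.\<close>

definition backward_shift :: "(complex \<Rightarrow> complex) \<Rightarrow> complex \<Rightarrow> complex" where
  "backward_shift f = (\<lambda>z. if z \<notin> unit_disc then 0
     else if z = 0 then deriv f 0 else (f z - f 0) / z)"

definition inner_function :: "(complex \<Rightarrow> complex) \<Rightarrow> bool" where
  "inner_function \<theta> \<longleftrightarrow> \<theta> holomorphic_on unit_disc \<and> bounded (\<theta> ` unit_disc) \<and>
     (AE \<zeta> in circle_measure.
        \<exists>w. ((\<lambda>r. \<theta> (of_real r * \<zeta>)) \<longlongrightarrow> w) (at_left 1) \<and> cmod w = 1)"

definition model_space :: "(complex \<Rightarrow> complex) \<Rightarrow> (complex \<Rightarrow> complex) set" where
  "model_space \<theta> = {f \<in> hardy2. \<forall>h\<in>hardy2. h2_inner f (\<lambda>z. \<theta> z * h z) = 0}"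

definition rational_on_disc :: "(complex \<Rightarrow> complex) \<Rightarrow> bool" where
  "rational_on_disc \<theta> \<longleftrightarrow>
     (\<exists>p q. \<forall>z\<in>unit_disc. poly q z \<noteq> 0 \<and> \<theta> z = poly p z / poly q z)"

section \<open>Nearly invariant and almost-invariant subspaces\<close>

definition nearly_invariant :: "(complex \<Rightarrow> complex) set \<Rightarrow> bool" where
  "nearly_invariant M \<longleftrightarrow> h2_subspace M \<and> (\<forall>f\<in>M. f 0 = 0 \<longrightarrow> backward_shift f \<in> M)"

definition sum_space ::
    "(complex \<Rightarrow> complex) set \<Rightarrow> (complex \<Rightarrow> complex) set \<Rightarrow> (complex \<Rightarrow> complex) set" where
  "sum_space M F = {m + f | m f. m \<in> M \<and> f \<in> F}"

definition almost_invariant_via ::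
    "((complex \<Rightarrow> complex) \<Rightarrow> complex \<Rightarrow> complex) \<Rightarrow>
     (complex \<Rightarrow> complex) set \<Rightarrow> (complex \<Rightarrow> complex) set \<Rightarrow> bool" where
  "almost_invariant_via T M F \<longleftrightarrow>
     h2_subspace F \<and> finite_dimensional F \<and> T ` M \<subseteq> sum_space M F"

definition almost_invariant ::
    "((complex \<Rightarrow> complex) \<Rightarrow> complex \<Rightarrow> complex) \<Rightarrow> (complex \<Rightarrow> complex) set \<Rightarrow> bool" where
  "almost_invariant T M \<longleftrightarrow> h2_subspace M \<and> (\<exists>F. almost_invariant_via T M F)"

text \<open>Meaningful only for almost-invariant \<open>M\<close>.\<close>

definition defect ::
    "((complex \<Rightarrow> complex) \<Rightarrow> complex \<Rightarrow> complex) \<Rightarrow> (complex \<Rightarrow> complex) set \<Rightarrow> nat" where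
  "defect T M = (LEAST n. \<exists>F. almost_invariant_via T M F \<and> cfun.dim F = n)"

definition half_space :: "(complex \<Rightarrow> complex) set \<Rightarrow> bool" where
  "half_space M \<longleftrightarrow> h2_subspace M \<and> \<not> finite_dimensional M \<and>
     \<not> (\<exists>F. h2_subspace F \<and> finite_dimensional F \<and> sum_space M F = hardy2)"

end

theory Submission
  imports Defs "HOL-Probability.Probability_Measure"
begin

text \<open>The model space of \<open>\<theta>\<close> is written \<open>K\<close> here, and \<open>S\<close> is the shift. For \<open>k\<close> in \<open>K\<close> the function \<open>z k\<close>
  fails to be orthogonal to \<open>\<theta> H\<^sup>2\<close> only in the direction of \<open>\<theta>\<close>, so \<open>S K\<close> is contained in \<open>K\<close>
  plus the line of \<open>\<theta>\<close> (\<open>shift_model_space\<close>). Multiplication by \<open>g\<close> commutes with \<open>S\<close>, hence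
  \<open>S M\<close> is contained in \<open>M\<close> plus the line of \<open>g \<theta>\<close>, and the defect is at most \<open>1\<close>. It is not \<open>0\<close>:
  \<open>g\<close> belongs to \<open>M\<close>, so an invariant \<open>M\<close> would contain every \<open>g z\<^sup>n\<close>, and \<open>K\<close>
  would contain every \<open>z\<^sup>n\<close>. But then all Taylor coefficients of \<open>\<theta>\<close> would vanish
  (\<open>ex_disc_power_notin_model_space\<close>).

  \<open>M\<close> has infinite codimension because the functions \<open>g \<theta> z\<^sup>n\<close> are linearly independent modulo \<open>M\<close>; this
  amounts to \<open>K\<close> and \<open>\<theta> H\<^sup>2\<close> meeting only in \<open>0\<close> (\<open>infinite_codimension\<close>). If \<open>M\<close> has finite
  dimension, then the iterated backward shifts of \<open>\<theta>\<close>, which all lie in \<open>K\<close>, satisfy a linear relation;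
  cleared of denominators, it reads \<open>q \<theta> = p\<close> with polynomials \<open>q \<noteq> 0\<close> and \<open>p\<close>, so \<open>\<theta>\<close> is rational
  (\<open>rational_if_finite_dimensional\<close>).

  The analytic input is the description of the Hardy space by square-summable Taylor coefficients
  (\<open>hardy2_iff\<close>, \<open>h2_inner_eq\<close>), for which boundary values have to be constructed
  (\<open>ex_boundary_values\<close>), and the orthogonality of \<open>\<theta>\<close> to \<open>z \<theta> H\<^sup>2\<close>
  (\<open>theta_orthogonal_shift\<close>), which expresses that \<open>\<bar>\<theta>\<bar> = 1\<close> almost everywhere on the circle.\<close>

section \<open>The circle measure\<close>

lemma sets_circle_measure [measurable_cong, simp]: "sets circle_measure = sets borel"
  by (simp add: circle_measure_def)

lemma space_circle_measure [simp]: "space circle_measure = UNIV"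
  by (simp add: circle_measure_def)

lemma cis_measurable [measurable]: "cis \<in> borel_measurable borel"
  by (intro borel_measurable_continuous_onI) (auto intro!: continuous_intros simp: cis_conv_exp)

lemma cnj_measurable [measurable]: "cnj \<in> borel_measurable borel"
  by (intro borel_measurable_continuous_onI) (auto intro!: continuous_intros)

lemma prob_space_circle: "prob_space circle_measure"
  unfolding circle_measure_def
  by (intro prob_space.prob_space_distr prob_space_uniform_measure) auto

interpretation circle: prob_space circle_measure
  by (rule prob_space_circle)

text \<open>The measure lives on the whole plane, so pointwise facts about the circle enter the integrals as
  almost-everywhere facts.\<close>

lemma AE_circle_norm: "AE \<zeta> in circle_measure. cmod \<zeta> = 1"
  unfolding circle_measure_def by (subst AE_distr_iff) auto

lemma integral_circle:
  fixes \<phi> :: "complex \<Rightarrow> complex"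
  assumes [measurable]: "\<phi> \<in> borel_measurable borel"
  shows "(LINT \<zeta>|circle_measure. \<phi> \<zeta>)
    = (LINT t|lborel. indicator {0..2*pi} t *\<^sub>R (\<phi> (cis t) / (2 * pi)))"
proof -
  have "uniform_measure lborel {0..2*pi}
      = density lborel (\<lambda>t. ennreal (indicator {0..2*pi} t / (2*pi)))"
    unfolding uniform_measure_def
    by (intro density_cong) (auto simp: indicator_def divide_ennreal[of 1, simplified])
  then have "(LINT \<zeta>|circle_measure. \<phi> \<zeta>)
      = (LINT t|density lborel (\<lambda>t. ennreal (indicator {0..2*pi} t / (2*pi))). \<phi> (cis t))"
    unfolding circle_measure_def by (subst integral_distr) auto
  also have "\<dots> = (LINT t|lborel. indicator {0..2*pi} t *\<^sub>R (\<phi> (cis t) / (2 * pi)))"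
    by (subst integral_density) (auto intro!: Bochner_Integration.integral_cong simp: scaleR_conv_of_real)
  finally show ?thesis .
qed

lemma integral_circle_monomials:
  "(LINT \<zeta>|circle_measure. \<zeta> ^ n * cnj \<zeta> ^ m) = (if n = m then 1 else 0)"
proof -
  (* On the circle the integrand is cis (k t); this writes both cases as an integral of cis. *)
  define k where "k = real n - real m"
  have *: "cis t ^ n * cnj (cis t) ^ m = cis (k * t)" for t
    by (simp add: k_def Complex.DeMoivre cis_cnj cis_mult algebra_simps)
  have I: "(LINT \<zeta>|circle_measure. \<zeta> ^ n * cnj \<zeta> ^ m)
      = (LINT t|lborel. indicator {0..2*pi} t *\<^sub>R (cis (k * t) / (2 * pi)))"
    by (subst integral_circle) (auto simp: *)
  show ?thesis
  proof (cases "n = m")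
    case True
    have "(LINT t|lborel. indicator {0..2*pi} t *\<^sub>R (1 / complex_of_real (2 * pi)))
        = complex_of_real (2*pi) / complex_of_real (2 * pi) - complex_of_real 0 / complex_of_real (2*pi)"
      by (rule integral_FTC_Icc) (auto intro!: derivative_eq_intros)
    then show ?thesis using I True by (simp add: k_def)
  next
    case False
    then have k: "k \<noteq> 0" by (simp add: k_def)
    have "(LINT t|lborel. indicator {0..2*pi} t *\<^sub>R (cis (k * t) / (2 * pi)))
        = cis (k * (2*pi)) / (\<i> * k * (2 * pi)) - cis (k * 0) / (\<i> * k * (2*pi))"
    proof (rule integral_FTC_Icc)
      fix x :: real
      have "((\<lambda>t. exp (\<i> * of_real k * t) / (\<i> * k * (2*pi))) has_field_derivative
               exp (\<i> * of_real k * of_real x) / (2 * pi)) (at (of_real x))"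
        using k by (auto intro!: derivative_eq_intros simp: field_simps)
      from has_vector_derivative_real_field[OF this]
      show "((\<lambda>t. cis (k * t) / (\<i> * k * (2*pi))) has_vector_derivative cis (k * x) / (2*pi))
            (at x within {0..2*pi})"
        by (auto simp: cis_conv_exp o_def mult_ac intro: has_vector_derivative_at_within)
    qed (auto intro!: continuous_intros simp: cis_conv_exp)
    moreover have "cis (k * (2*pi)) = 1"
      using cis_multiple_2pi[of k] by (simp add: k_def mult_ac)
    ultimately show ?thesis using I False by simp
  qed
qed

section \<open>Auxiliary inequalities and limits\<close>

text \<open>The integral of \<open>(t * \<bar>u\<bar> - \<bar>v\<bar>)\<^sup>2\<close> is a quadratic polynomial in the real number \<open>t\<close> that is nowhere
  negative. Evaluating it at its vertex gives the inequality; if its leading coefficient is \<open>0\<close>,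
  it is affine and its slope must vanish as well.\<close>

lemma Cauchy_Schwarz_integral:
  fixes u v :: "'a \<Rightarrow> complex"
  assumes [measurable]: "u \<in> borel_measurable M" "v \<in> borel_measurable M"
    and u: "integrable M (\<lambda>x. (cmod (u x))\<^sup>2)" and v: "integrable M (\<lambda>x. (cmod (v x))\<^sup>2)"
  shows integrable_mult_cnj: "integrable M (\<lambda>x. u x * cnj (v x))"
    and cmod_integral_mult_cnj: "cmod (LINT x|M. u x * cnj (v x))
      \<le> sqrt (LINT x|M. (cmod (u x))\<^sup>2) * sqrt (LINT x|M. (cmod (v x))\<^sup>2)"
proof -
  have amgm: "2 * (a * b) \<le> a\<^sup>2 + b\<^sup>2" for a b :: real
    using zero_le_power2[of "a - b"] by (simp add: power2_eq_square algebra_simps)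
  show int: "integrable M (\<lambda>x. u x * cnj (v x))"
  proof (rule Bochner_Integration.integrable_bound[OF Bochner_Integration.integrable_add[OF u v]])
    show "AE x in M. norm (u x * cnj (v x)) \<le> norm ((cmod (u x))\<^sup>2 + (cmod (v x))\<^sup>2)"
    proof (intro AE_I2)
      fix x
      have "0 \<le> cmod (u x) * cmod (v x)" by simp
      then have "cmod (u x) * cmod (v x) \<le> (cmod (u x))\<^sup>2 + (cmod (v x))\<^sup>2"
        using amgm[of "cmod (u x)" "cmod (v x)"] by linarith
      then show "norm (u x * cnj (v x)) \<le> norm ((cmod (u x))\<^sup>2 + (cmod (v x))\<^sup>2)"
        by (simp add: norm_mult)
    qed
  qed simp
  define A where "A = (LINT x|M. (cmod (u x))\<^sup>2)"
  define B where "B = (LINT x|M. (cmod (v x))\<^sup>2)"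
  define I where "I = (LINT x|M. cmod (u x) * cmod (v x))"
  have int': "integrable M (\<lambda>x. cmod (u x) * cmod (v x))"
    using integrable_norm[OF int] by (simp add: norm_mult)
  have A0: "A \<ge> 0" by (simp add: A_def)
  have q: "0 \<le> t\<^sup>2 * A - 2 * t * I + B" for t
  proof -
    have "0 \<le> (LINT x|M. (t * cmod (u x) - cmod (v x))\<^sup>2)" by simp
    also have "\<dots> = (LINT x|M. t\<^sup>2 * (cmod (u x))\<^sup>2 - (2 * t) * (cmod (u x) * cmod (v x)) + (cmod (v x))\<^sup>2)"
      by (intro Bochner_Integration.integral_cong) (auto simp: power2_eq_square algebra_simps)
    also have "\<dots> = t\<^sup>2 * A - 2 * t * I + B"
      using u v int' by (simp add: A_def B_def I_def)
    finally show ?thesis .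
  qed
  have "I\<^sup>2 \<le> A * B"
  proof (cases "A = 0")
    case True
    have "I = 0"
    proof (rule ccontr)
      assume "I \<noteq> 0"
      then have "2 * ((B + 1) / (2 * I)) * I = B + 1" by simp
      then show False using q[of "(B + 1) / (2 * I)"] True by simp
    qed
    then show ?thesis using True by simp
  next
    case False
    then have "0 \<le> A * ((I / A)\<^sup>2 * A - 2 * (I / A) * I + B)"
      by (intro mult_nonneg_nonneg A0 q)
    also have "\<dots> = A * B - I\<^sup>2" using False by (simp add: field_simps power2_eq_square)
    finally show ?thesis by simp
  qed
  then have "I \<le> sqrt A * sqrt B"
    by (metis real_le_rsqrt real_sqrt_mult)
  moreover have "cmod (LINT x|M. u x * cnj (v x)) \<le> I"
    unfolding I_def using integral_norm_bound[of M "\<lambda>x. u x * cnj (v x)"] by (simp add: norm_mult)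
  ultimately show "cmod (LINT x|M. u x * cnj (v x))
      \<le> sqrt (LINT x|M. (cmod (u x))\<^sup>2) * sqrt (LINT x|M. (cmod (v x))\<^sup>2)"
    by (simp add: A_def B_def)
qed

lemma cmod_diff_sq_le: "(cmod (x - y))\<^sup>2 \<le> 2 * (cmod x)\<^sup>2 + 2 * (cmod y)\<^sup>2"
proof -
  have "(cmod (x - y))\<^sup>2 \<le> (cmod x + cmod y)\<^sup>2" by (intro power_mono norm_triangle_ineq4) auto
  also have "\<dots> \<le> 2 * (cmod x)\<^sup>2 + 2 * (cmod y)\<^sup>2"
    using sum_squares_bound[of "cmod x" "cmod y"] by (simp add: power2_sum)
  finally show ?thesis .
qed

text \<open>Tannery's theorem: a summable majorant makes the convergence of the partial sums uniform, and a
  uniform limit may be exchanged with a pointwise one.\<close>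

lemma tendsto_suminf_dominated:
  fixes f :: "nat \<Rightarrow> 'a \<Rightarrow> 'b::banach"
  assumes lim: "\<And>n. (f n \<longlongrightarrow> l n) F" and M: "summable M"
    and bound: "\<And>n x. x \<in> A \<Longrightarrow> norm (f n x) \<le> M n"
    and ev: "eventually (\<lambda>x. x \<in> A) F" and F: "F \<noteq> bot"
  shows "((\<lambda>x. \<Sum>n. f n x) \<longlongrightarrow> (\<Sum>n. l n)) F"
proof -
  have ln: "norm (l n) \<le> M n" for n
  proof (rule tendsto_upperbound[OF tendsto_norm[OF lim] _ F])
    show "eventually (\<lambda>x. norm (f n x) \<le> M n) F"
      using ev by eventually_elim (rule bound)
  qed
  have l: "summable l"
    by (rule summable_comparison_test'[OF M ln])
  have ul: "uniform_limit A (\<lambda>n x. \<Sum>i<n. f i x) (\<lambda>x. \<Sum>i. f i x) sequentially"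
    by (rule Weierstrass_m_test[OF bound M])
  show "((\<lambda>x. \<Sum>n. f n x) \<longlongrightarrow> (\<Sum>n. l n)) F"
    by (rule swap_uniform_limit'[OF _ summable_LIMSEQ[OF l] ul ev])
       (auto intro!: tendsto_sum lim always_eventually)
qed

section \<open>Series on the circle\<close>

text \<open>For absolutely summable coefficients this is a function in the Wiener algebra. Dilates and
  partial sums of a power series both have this form on the circle, so one Parseval identity
  serves for all of them and for their differences.\<close>

definition circle_series :: "(nat \<Rightarrow> complex) \<Rightarrow> complex \<Rightarrow> complex" where
  "circle_series a \<zeta> = (\<Sum>n. a n * \<zeta> ^ n)"

lemma circle_series_measurable [measurable]: "circle_series a \<in> borel_measurable borel"
  unfolding circle_series_def[abs_def] by measurable

lemma summable_circle_series:
  assumes "summable (\<lambda>n. cmod (a n))" "cmod \<zeta> = 1"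
  shows "summable (\<lambda>n. a n * \<zeta> ^ n)"
  using assms by (intro summable_norm_cancel[of "\<lambda>n. a n * \<zeta> ^ n"]) (simp add: norm_mult norm_power)

lemma circle_series_diff:
  assumes "summable (\<lambda>n. cmod (a n))" "summable (\<lambda>n. cmod (b n))" "cmod \<zeta> = 1"
  shows "circle_series (\<lambda>n. a n - b n) \<zeta> = circle_series a \<zeta> - circle_series b \<zeta>"
  unfolding circle_series_def
  by (subst suminf_diff) (auto intro!: summable_circle_series assms simp: algebra_simps)

lemma cmod_circle_series_le:
  assumes "summable (\<lambda>n. cmod (a n))" "cmod \<zeta> = 1"
  shows "cmod (circle_series a \<zeta>) \<le> (\<Sum>n. cmod (a n))"
  unfolding circle_series_def
  using summable_norm[of "\<lambda>n. a n * \<zeta> ^ n"] assms by (simp add: norm_mult norm_power)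

lemma integral_circle_series_mult:
  assumes a: "summable (\<lambda>n. cmod (a n))"
    and [measurable]: "\<phi> \<in> borel_measurable borel"
    and b: "\<And>\<zeta>. cmod \<zeta> = 1 \<Longrightarrow> cmod (\<phi> \<zeta>) \<le> K"
  shows "(LINT \<zeta>|circle_measure. circle_series a \<zeta> * \<phi> \<zeta>)
    = (\<Sum>n. a n * (LINT \<zeta>|circle_measure. \<zeta> ^ n * \<phi> \<zeta>))"
proof -
  have bn: "AE \<zeta> in circle_measure. cmod (a n * \<zeta> ^ n * \<phi> \<zeta>) \<le> cmod (a n) * K" for n
    using AE_circle_norm by eventually_elim (auto simp: norm_mult norm_power intro!: mult_left_mono b)
  have int: "integrable circle_measure (\<lambda>\<zeta>. a n * \<zeta> ^ n * \<phi> \<zeta>)" for n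
    by (rule circle.integrable_const_bound[OF bn]) simp
  have "AE \<zeta> in circle_measure. circle_series a \<zeta> * \<phi> \<zeta> = (\<Sum>n. a n * \<zeta> ^ n * \<phi> \<zeta>)"
    using AE_circle_norm unfolding circle_series_def
    by eventually_elim (intro suminf_mult2 summable_circle_series a)
  then have "(LINT \<zeta>|circle_measure. circle_series a \<zeta> * \<phi> \<zeta>)
      = (LINT \<zeta>|circle_measure. (\<Sum>n. a n * \<zeta> ^ n * \<phi> \<zeta>))"
    by (intro integral_cong_AE) auto
  also have "\<dots> = (\<Sum>n. LINT \<zeta>|circle_measure. a n * \<zeta> ^ n * \<phi> \<zeta>)"
  proof (rule integral_suminf[OF int])
    show "AE \<zeta> in circle_measure. summable (\<lambda>n. cmod (a n * \<zeta> ^ n * \<phi> \<zeta>))"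
      using AE_circle_norm
    proof eventually_elim
      case (elim \<zeta>)
      then show ?case
        using summable_mult2[OF a, of "cmod (\<phi> \<zeta>)"] by (simp add: norm_mult norm_power)
    qed
    have "(LINT \<zeta>|circle_measure. cmod (a n * \<zeta> ^ n * \<phi> \<zeta>)) \<le> cmod (a n) * K" for n
      by (rule circle.integral_le_const[OF integrable_norm[OF int] bn])
    then show "summable (\<lambda>n. LINT \<zeta>|circle_measure. cmod (a n * \<zeta> ^ n * \<phi> \<zeta>))"
      by (intro summable_comparison_test'[OF summable_mult2[OF a, of K]]) auto
  qed
  also have "\<dots> = (\<Sum>n. a n * (LINT \<zeta>|circle_measure. \<zeta> ^ n * \<phi> \<zeta>))"
    by (simp add: mult.assoc)
  finally show ?thesis .
qed

text \<open>Parseval: the orthonormality of the monomials, applied once to the series of \<open>b\<close> to recover its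
  coefficients and once more to the series of \<open>a\<close>.\<close>

lemma integral_circle_series_mult_cnj:
  assumes a: "summable (\<lambda>n. cmod (a n))" and b: "summable (\<lambda>n. cmod (b n))"
  shows "(LINT \<zeta>|circle_measure. circle_series a \<zeta> * cnj (circle_series b \<zeta>)) = (\<Sum>n. a n * cnj (b n))"
proof -
  have coeff: "(LINT \<zeta>|circle_measure. circle_series b \<zeta> * cnj \<zeta> ^ n) = b n" for n
  proof -
    have "(LINT \<zeta>|circle_measure. circle_series b \<zeta> * cnj \<zeta> ^ n)
        = (\<Sum>m. b m * (LINT \<zeta>|circle_measure. \<zeta> ^ m * cnj \<zeta> ^ n))"
      by (rule integral_circle_series_mult[where K = 1, OF b]) (auto simp: norm_power)
    also have "\<dots> = (\<Sum>m. if m = n then b m else 0)"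
      by (simp add: integral_circle_monomials if_distrib cong: if_cong)
    also have "\<dots> = b n" by (rule sums_unique[OF sums_single, symmetric])
    finally show ?thesis .
  qed
  have "(LINT \<zeta>|circle_measure. \<zeta> ^ n * cnj (circle_series b \<zeta>)) = cnj (b n)" for n
  proof -
    have "(LINT \<zeta>|circle_measure. \<zeta> ^ n * cnj (circle_series b \<zeta>))
      = (LINT \<zeta>|circle_measure. cnj (circle_series b \<zeta> * cnj \<zeta> ^ n))"
      by (simp add: mult.commute)
    also have "\<dots> = cnj (b n)"
      by (simp add: coeff del: complex_cnj_mult)
    finally show ?thesis .
  qed
  then show ?thesis
    by (subst integral_circle_series_mult[OF a _ ]) (auto intro: cmod_circle_series_le[OF b])
qed

lemma integrable_circle_series_sq:
  assumes a: "summable (\<lambda>n. cmod (a n))"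
  shows "integrable circle_measure (\<lambda>\<zeta>. (cmod (circle_series a \<zeta>))\<^sup>2)"
  by (rule circle.integrable_const_bound[where B = "(\<Sum>n. cmod (a n))\<^sup>2"])
     (use AE_circle_norm in \<open>auto elim!: eventually_mono intro!: power_mono cmod_circle_series_le a\<close>)

lemma summable_sq_if_summable:
  fixes x :: "nat \<Rightarrow> real"
  assumes "summable x" "\<And>n. 0 \<le> x n"
  shows "summable (\<lambda>n. (x n)\<^sup>2)"
proof -
  have "eventually (\<lambda>n. x n < 1) sequentially"
    using order_tendstoD(2)[OF summable_LIMSEQ_zero[OF assms(1)], of 1] by simp
  then have "eventually (\<lambda>n. norm ((x n)\<^sup>2) \<le> x n) sequentially"
    by eventually_elim (use assms(2) in \<open>auto simp: power2_eq_square intro!: mult_left_le\<close>)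
  then show ?thesis
    by (rule summable_comparison_test_ev[OF _ assms(1)])
qed

lemma integral_circle_series_sq:
  assumes a: "summable (\<lambda>n. cmod (a n))"
  shows "(LINT \<zeta>|circle_measure. (cmod (circle_series a \<zeta>))\<^sup>2) = (\<Sum>n. (cmod (a n))\<^sup>2)"
proof -
  have "complex_of_real (LINT \<zeta>|circle_measure. (cmod (circle_series a \<zeta>))\<^sup>2)
      = (LINT \<zeta>|circle_measure. circle_series a \<zeta> * cnj (circle_series a \<zeta>))"
    unfolding integral_complex_of_real[symmetric]
    by (intro Bochner_Integration.integral_cong refl complex_norm_square)
  also have "\<dots> = (\<Sum>n. complex_of_real ((cmod (a n))\<^sup>2))"
    by (simp only: integral_circle_series_mult_cnj[OF a a] complex_norm_square)
  also have "\<dots> = complex_of_real (\<Sum>n. (cmod (a n))\<^sup>2)"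
    by (intro suminf_of_real[symmetric] summable_sq_if_summable a) auto
  finally show ?thesis by (simp only: of_real_eq_iff)
qed

section \<open>Taylor coefficients and dilates\<close>

definition taylor_coeff :: "(complex \<Rightarrow> complex) \<Rightarrow> nat \<Rightarrow> complex" where
  "taylor_coeff f n = (deriv ^^ n) f 0 / fact n"

lemma sums_taylor:
  assumes "f holomorphic_on unit_disc" "z \<in> unit_disc"
  shows "(\<lambda>n. taylor_coeff f n * z ^ n) sums f z"
  using holomorphic_power_series[OF assms] by (simp add: taylor_coeff_def)

text \<open>By uniqueness of power series, the coefficients of sums, shifts and monomials can be read off
  from an expansion without computing derivatives.\<close>

lemma taylor_coeff_eqI:
  assumes "\<And>z. z \<in> unit_disc \<Longrightarrow> (\<lambda>n. a n * z ^ n) sums f z"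
  shows "taylor_coeff f = a"
proof
  fix n
  have "f has_fps_expansion Abs_fps a"
    by (rule has_fps_expansionI)
       (use assms in \<open>auto intro!: eventually_mono[OF eventually_nhds_in_open[of unit_disc 0]]\<close>)
  from fps_nth_fps_expansion[OF this, of n] show "taylor_coeff f n = a n"
    by (simp add: taylor_coeff_def)
qed

text \<open>The Hardy space without its growth condition. Dilates and Taylor coefficients make sense for these
  functions, and the growth condition is then characterized in terms of the coefficients.\<close>

definition disc_holo :: "(complex \<Rightarrow> complex) set" where
  "disc_holo = {f. f holomorphic_on unit_disc \<and> (\<forall>z. z \<notin> unit_disc \<longrightarrow> f z = 0)}"

lemma disc_holo_measurable:
  assumes "f \<in> disc_holo" shows "f \<in> borel_measurable borel"
proof -
  have "(\<lambda>x. indicator unit_disc x *\<^sub>R f x) \<in> borel_measurable borel"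
    using assms by (intro borel_measurable_continuous_on_indicator)
      (auto simp: disc_holo_def holomorphic_on_imp_continuous_on)
  also have "(\<lambda>x. indicator unit_disc x *\<^sub>R f x) = f"
    using assms by (auto simp: fun_eq_iff disc_holo_def indicator_def)
  finally show ?thesis .
qed

lemma dilate_measurable [measurable (raw)]:
  assumes "f \<in> disc_holo" shows "(\<lambda>\<zeta>. f (c * \<zeta>)) \<in> borel_measurable borel"
  using disc_holo_measurable[OF assms] by measurable

lemma summable_taylor_radius:
  assumes f: "f \<in> disc_holo" and r: "0 \<le> r" "r < 1"
  shows "summable (\<lambda>n. cmod (taylor_coeff f n * of_real r ^ n))"
proof -
  (* any radius strictly between r and 1: convergence there gives absolute convergence at r *)
  define s where "s = (1 + r) / 2"
  have s: "0 \<le> s" "r < s" "s < 1" using r by (auto simp: s_def)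
  have "summable (\<lambda>n. taylor_coeff f n * of_real s ^ n)"
    using s f by (intro sums_summable[OF sums_taylor]) (auto simp: disc_holo_def)
  then show ?thesis
    by (rule powser_insidea) (use r s in auto)
qed

lemma dilate_eq_circle_series:
  assumes f: "f \<in> disc_holo" and r: "0 \<le> r" "r < 1" and "cmod \<zeta> = 1"
  shows "f (of_real r * \<zeta>) = circle_series (\<lambda>n. taylor_coeff f n * of_real r ^ n) \<zeta>"
proof -
  have "(\<lambda>n. taylor_coeff f n * (of_real r * \<zeta>) ^ n) sums f (of_real r * \<zeta>)"
    using assms by (intro sums_taylor) (auto simp: disc_holo_def norm_mult)
  then show ?thesis
    unfolding circle_series_def by (simp add: sums_iff power_mult_distrib mult_ac)
qed

lemma integral_dilate_mult_cnj:
  assumes f: "f \<in> disc_holo" and g: "g \<in> disc_holo" and r: "0 \<le> r" "r < 1"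
  shows "(LINT \<zeta>|circle_measure. f (of_real r * \<zeta>) * cnj (g (of_real r * \<zeta>)))
    = (\<Sum>n. taylor_coeff f n * cnj (taylor_coeff g n) * of_real (r ^ (2 * n)))"
proof -
  have "(LINT \<zeta>|circle_measure. f (of_real r * \<zeta>) * cnj (g (of_real r * \<zeta>)))
    = (LINT \<zeta>|circle_measure. circle_series (\<lambda>n. taylor_coeff f n * of_real r ^ n) \<zeta> *
         cnj (circle_series (\<lambda>n. taylor_coeff g n * of_real r ^ n) \<zeta>))"
    using AE_circle_norm f g
    by (intro integral_cong_AE)
       (auto elim!: eventually_mono simp: dilate_eq_circle_series r intro!: borel_measurable_times
          measurable_compose[OF _ cnj_measurable] dilate_measurable)
  also have "\<dots> = (\<Sum>n. taylor_coeff f n * cnj (taylor_coeff g n) * of_real (r ^ (2 * n)))"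
    by (subst integral_circle_series_mult_cnj)
       (auto intro!: summable_taylor_radius f g r suminf_cong simp: mult_ac power_mult power2_eq_square)
  finally show ?thesis .
qed

lemma integrable_dilate_sq:
  assumes f: "f \<in> disc_holo" and r: "0 \<le> r" "r < 1"
  shows "integrable circle_measure (\<lambda>\<zeta>. (cmod (f (of_real r * \<zeta>)))\<^sup>2)"
proof -
  have "AE \<zeta> in circle_measure. (cmod (f (of_real r * \<zeta>)))\<^sup>2
      = (cmod (circle_series (\<lambda>n. taylor_coeff f n * of_real r ^ n) \<zeta>))\<^sup>2"
    using AE_circle_norm by eventually_elim (simp add: dilate_eq_circle_series f r)
  note * = integrable_cong_AE[OF _ _ this]
  show ?thesis
    by (subst *) (use f in \<open>auto intro!: integrable_circle_series_sq summable_taylor_radius f r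
      borel_measurable_power borel_measurable_norm dilate_measurable\<close>)
qed

lemma integral_dilate_sq:
  assumes f: "f \<in> disc_holo" and r: "0 \<le> r" "r < 1"
  shows "(LINT \<zeta>|circle_measure. (cmod (f (of_real r * \<zeta>)))\<^sup>2)
    = (\<Sum>n. (cmod (taylor_coeff f n * of_real r ^ n))\<^sup>2)"
proof -
  have "(LINT \<zeta>|circle_measure. (cmod (f (of_real r * \<zeta>)))\<^sup>2)
    = (LINT \<zeta>|circle_measure. (cmod (circle_series (\<lambda>n. taylor_coeff f n * of_real r ^ n) \<zeta>))\<^sup>2)"
    using AE_circle_norm f 
    by (intro integral_cong_AE)
       (auto elim!: eventually_mono simp: dilate_eq_circle_series r intro!: 
         borel_measurable_power borel_measurable_norm dilate_measurable)
  also have "\<dots> = (\<Sum>n. (cmod (taylor_coeff f n * of_real r ^ n))\<^sup>2)"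
    by (rule integral_circle_series_sq[OF summable_taylor_radius[OF f r]])
  finally show ?thesis .
qed

section \<open>Hardy space and square-summable coefficients\<close>

lemma integral_dilate_sq_le:
  assumes f: "f \<in> disc_holo" and sq: "summable (\<lambda>n. (cmod (taylor_coeff f n))\<^sup>2)"
    and r: "0 \<le> r" "r < 1"
  shows "(LINT \<zeta>|circle_measure. (cmod (f (of_real r * \<zeta>)))\<^sup>2) \<le> (\<Sum>n. (cmod (taylor_coeff f n))\<^sup>2)"
  unfolding integral_dilate_sq[OF f r]
proof (rule suminf_le[OF _ _ sq])
  show "(cmod (taylor_coeff f n * of_real r ^ n))\<^sup>2 \<le> (cmod (taylor_coeff f n))\<^sup>2" for n
    using r by (auto simp: norm_mult norm_power intro!: power_mono mult_left_le power_le_one)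
qed (intro summable_sq_if_summable summable_taylor_radius f r, simp)

text \<open>The square means of the dilates are \<open>\<Sum>\<bar>a\<^sub>n\<bar>\<^sup>2 r\<^bsup>2n\<^esup>\<close> by Parseval. They are dominated by
  \<open>\<Sum>\<bar>a\<^sub>n\<bar>\<^sup>2\<close>, and conversely a common bound for all \<open>r < 1\<close> passes to every partial sum at \<open>r = 1\<close>.\<close>

lemma hardy2_iff:
  "f \<in> hardy2 \<longleftrightarrow> f \<in> disc_holo \<and> summable (\<lambda>n. (cmod (taylor_coeff f n))\<^sup>2)"
proof
  assume f: "f \<in> hardy2"
  then have d: "f \<in> disc_holo" by (auto simp: hardy2_def disc_holo_def)
  obtain C where C0: "\<forall>r\<in>{0..<1}. (LINT \<zeta>|circle_measure. (cmod (f (of_real r * \<zeta>)))\<^sup>2) \<le> C"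
    using f unfolding hardy2_def by blast
  then have C: "(LINT \<zeta>|circle_measure. (cmod (f (of_real r * \<zeta>)))\<^sup>2) \<le> C" if "0 \<le> r" "r < 1" for r
    using that by auto
  have "(\<Sum>n<N. (cmod (taylor_coeff f n))\<^sup>2) \<le> C" for N
  proof (rule tendsto_upperbound)
    show "((\<lambda>r. \<Sum>n<N. (cmod (taylor_coeff f n * of_real r ^ n))\<^sup>2)
        \<longlongrightarrow> (\<Sum>n<N. (cmod (taylor_coeff f n))\<^sup>2)) (at_left 1)"
      by (rule tendsto_eq_intros refl | simp)+
    have "(\<Sum>n<N. (cmod (taylor_coeff f n * of_real r ^ n))\<^sup>2) \<le> C" if r: "0 \<le> r" "r < 1" for r
    proof -
      have "(\<Sum>n<N. (cmod (taylor_coeff f n * of_real r ^ n))\<^sup>2)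
          \<le> (\<Sum>n. (cmod (taylor_coeff f n * of_real r ^ n))\<^sup>2)"
        by (intro sum_le_suminf summable_sq_if_summable summable_taylor_radius d r) auto
      also have "\<dots> \<le> C"
        using C[OF r] integral_dilate_sq[OF d r] by simp
      finally show ?thesis .
    qed
    then show "eventually (\<lambda>r. (\<Sum>n<N. (cmod (taylor_coeff f n * of_real r ^ n))\<^sup>2) \<le> C) (at_left 1)"
      by (auto simp: eventually_at_left[of 0 "1::real"] intro!: exI[of _ 0])
  qed simp
  then show "f \<in> disc_holo \<and> summable (\<lambda>n. (cmod (taylor_coeff f n))\<^sup>2)"
    using d summableI_nonneg_bounded[of "\<lambda>n. (cmod (taylor_coeff f n))\<^sup>2" C] by simp
next
  assume f: "f \<in> disc_holo \<and> summable (\<lambda>n. (cmod (taylor_coeff f n))\<^sup>2)"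
  then have "(LINT \<zeta>|circle_measure. (cmod (f (of_real r * \<zeta>)))\<^sup>2) \<le> (\<Sum>n. (cmod (taylor_coeff f n))\<^sup>2)"
    if "0 \<le> r" "r < 1" for r
    using that by (intro integral_dilate_sq_le) auto
  then show "f \<in> hardy2"
    using f by (auto simp: hardy2_def disc_holo_def intro!: exI[of _ "\<Sum>n. (cmod (taylor_coeff f n))\<^sup>2"])
qed

lemma eventually_at_left_1: "(\<And>r. 0 \<le> r \<Longrightarrow> r < 1 \<Longrightarrow> P r) \<Longrightarrow> eventually P (at_left (1::real))"
  by (auto simp: eventually_at_left[of 0 "1::real"] intro!: exI[of _ 0])

section \<open>Existence of boundary values\<close>

text \<open>The sum is the squared distance in \<open>L\<^sup>2\<close> of the circle between a
  Hardy space function and its dilate.\<close>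

lemma tendsto_dilation_error:
  assumes "summable (\<lambda>n. (cmod (a n))\<^sup>2)"
  shows "((\<lambda>r. \<Sum>n. (cmod (a n))\<^sup>2 * (1 - r ^ n)\<^sup>2) \<longlongrightarrow> 0) (at_left (1::real))"
proof -
  have "((\<lambda>r. \<Sum>n. (cmod (a n))\<^sup>2 * (1 - r ^ n)\<^sup>2) \<longlongrightarrow> (\<Sum>n. 0)) (at_left (1::real))"
  proof (rule tendsto_suminf_dominated[where A = "{0..<1}" and M = "\<lambda>n. (cmod (a n))\<^sup>2"])
    show "((\<lambda>r. (cmod (a n))\<^sup>2 * (1 - r ^ n)\<^sup>2) \<longlongrightarrow> 0) (at_left (1::real))" for n
      by (rule tendsto_eq_intros refl | simp)+
    show "norm ((cmod (a n))\<^sup>2 * (1 - r ^ n)\<^sup>2) \<le> (cmod (a n))\<^sup>2" if "r \<in> {0..<1}" for n r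
      using that by (auto simp: power_le_one intro!: mult_left_le)
  qed (use assms in \<open>auto intro!: eventually_at_left_1\<close>)
  then show ?thesis by simp
qed

text \<open>The measure has total mass \<open>1\<close>, so by Cauchy-Schwarz the \<open>L\<^sup>1\<close> norms are at most \<open>(1/2)\<^bsup>k\<^esup>\<close>. Hence
  the sum of the moduli has a finite integral and is finite almost everywhere.\<close>

lemma L2_norm_bound_imp_AE_convergent:
  fixes v :: "nat \<Rightarrow> complex \<Rightarrow> complex"
  assumes [measurable]: "\<And>k. v k \<in> borel_measurable borel"
    and int: "\<And>k. integrable circle_measure (\<lambda>\<zeta>. (cmod (v k \<zeta>))\<^sup>2)"
    and le: "\<And>k. (LINT \<zeta>|circle_measure. (cmod (v k \<zeta>))\<^sup>2) \<le> (1/4) ^ k"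
  shows "AE \<zeta> in circle_measure. summable (\<lambda>k. cmod (v k \<zeta>))"
proof -
  have i: "integrable circle_measure (\<lambda>\<zeta>. cmod (v k \<zeta>))"
    and l: "(LINT \<zeta>|circle_measure. cmod (v k \<zeta>)) \<le> (1/2) ^ k" for k
  proof -
    have m: "(\<lambda>\<zeta>. complex_of_real (cmod (v k \<zeta>))) \<in> borel_measurable circle_measure" by simp
    have o: "integrable circle_measure (\<lambda>\<zeta>. (cmod 1)\<^sup>2)" by simp
    have s: "integrable circle_measure (\<lambda>\<zeta>. (cmod (complex_of_real (cmod (v k \<zeta>))))\<^sup>2)"
      using int by simp
    note CS = Cauchy_Schwarz_integral[OF m borel_measurable_const s o]
    show "integrable circle_measure (\<lambda>\<zeta>. cmod (v k \<zeta>))"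
      using integrable_norm[OF CS(1)] by simp
    have "(LINT \<zeta>|circle_measure. cmod (v k \<zeta>)) \<le> sqrt (LINT \<zeta>|circle_measure. (cmod (v k \<zeta>))\<^sup>2)"
      using CS(2) circle.prob_space by simp
    also have "\<dots> \<le> sqrt ((1/4) ^ k)" using le by simp
    also have "\<dots> = (1/2) ^ k" by (simp add: real_sqrt_power real_sqrt_divide)
    finally show "(LINT \<zeta>|circle_measure. cmod (v k \<zeta>)) \<le> (1/2) ^ k" .
  qed
  have "(\<integral>\<^sup>+ \<zeta>. (\<Sum>k. ennreal (cmod (v k \<zeta>))) \<partial>circle_measure)
      = (\<Sum>k. \<integral>\<^sup>+ \<zeta>. ennreal (cmod (v k \<zeta>)) \<partial>circle_measure)"
    by (rule nn_integral_suminf) simp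
  also have "\<dots> = (\<Sum>k. ennreal (LINT \<zeta>|circle_measure. cmod (v k \<zeta>)))"
    using i by (simp add: nn_integral_eq_integral)
  also have "\<dots> \<le> (\<Sum>k. ennreal ((1/2) ^ k))"
    by (intro suminf_le ennreal_leI l) auto
  also have "\<dots> = ennreal (\<Sum>k. (1/2) ^ k)"
    by (intro suminf_ennreal2 summable_geometric) auto
  also have "\<dots> < \<infinity>" by simp
  finally have "AE \<zeta> in circle_measure. (\<Sum>k. ennreal (cmod (v k \<zeta>))) \<noteq> \<infinity>"
    by (intro nn_integral_PInf_AE) auto
  then show ?thesis
    by eventually_elim (auto intro: summable_suminf_not_top)
qed

text \<open>The completeness argument of Riesz and Fischer. Partial sums of the Taylor series along a sequence
  of cut-offs \<open>M k\<close> with tails at most \<open>(1/4)\<^bsup>k\<^esup>\<close> converge almost everywhere to a function \<open>F\<close>.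
  Fatou's lemma bounds the distance of a dilate to \<open>F\<close> by its distances to the partial sums, which
  Parseval evaluates.\<close>

lemma ex_boundary_values:
  assumes f: "f \<in> hardy2"
  shows "\<exists>F. has_boundary_values f F"
proof -
  define a where "a = taylor_coeff f"
  have d: "f \<in> disc_holo" and sq: "summable (\<lambda>n. (cmod (a n))\<^sup>2)"
    using f by (auto simp: hardy2_iff a_def)
  have "\<exists>N. \<forall>m\<ge>N. \<forall>n. (\<Sum>i=m..<n. (cmod (a i))\<^sup>2) < (1/4) ^ k" for k
  proof -
    have "(0::real) < (1/4) ^ k" by simp
    then obtain N where "\<forall>m\<ge>N. \<forall>n. norm (\<Sum>i=m..<n. (cmod (a i))\<^sup>2) < (1/4) ^ k"
      using sq unfolding summable_Cauchy by blast
    then show ?thesis by (auto simp: sum_nonneg)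
  qed
  then obtain N where N: "\<And>k m n. m \<ge> N k \<Longrightarrow> (\<Sum>i=m..<n. (cmod (a i))\<^sup>2) < (1/4) ^ k"
    by metis
  (* The N k need not increase; their partial sums do, and keep the tail bound. *)
  define M where "M k = (\<Sum>i\<le>k. N i)" for k
  have MN: "N k \<le> M k" for k unfolding M_def by (rule member_le_sum) auto
  have M: "(\<Sum>i=M k..<n. (cmod (a i))\<^sup>2) \<le> (1/4) ^ k" for k n
    using N[OF MN] less_imp_le by blast
  define p where "p k n = (if n < M k then a n else 0)" for k n
  define P where "P k = circle_series (p k)" for k
  define F where "F \<zeta> = lim (\<lambda>k. P k \<zeta>)" for \<zeta>
  have Pm [measurable]: "P k \<in> borel_measurable borel" for k by (simp add: P_def)
  have Fm [measurable]: "F \<in> borel_measurable borel" unfolding F_def by measurable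
  have fm [measurable]: "(\<lambda>\<zeta>. f (c * \<zeta>)) \<in> borel_measurable borel" for c
    by (rule dilate_measurable[OF d])
  have ps: "summable (\<lambda>n. cmod (p k n))" for k
    by (rule summable_finite[of "{..<M k}"]) (auto simp: p_def)
  have "AE \<zeta> in circle_measure. summable (\<lambda>k. cmod (P (Suc k) \<zeta> - P k \<zeta>))"
  proof (rule L2_norm_bound_imp_AE_convergent)
    fix k
    have s: "summable (\<lambda>n. cmod (p (Suc k) n - p k n))"
      by (rule summable_finite[of "{..<M (Suc k) + M k}"]) (auto simp: p_def)
    have eq: "AE \<zeta> in circle_measure. (cmod (P (Suc k) \<zeta> - P k \<zeta>))\<^sup>2
        = (cmod (circle_series (\<lambda>n. p (Suc k) n - p k n) \<zeta>))\<^sup>2"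
      using AE_circle_norm by eventually_elim (simp add: P_def circle_series_diff ps)
    show "integrable circle_measure (\<lambda>\<zeta>. (cmod (P (Suc k) \<zeta> - P k \<zeta>))\<^sup>2)"
      by (subst integrable_cong_AE[OF _ _ eq]) (auto intro: integrable_circle_series_sq s)
    have "(LINT \<zeta>|circle_measure. (cmod (P (Suc k) \<zeta> - P k \<zeta>))\<^sup>2)
        = (\<Sum>n. (cmod (p (Suc k) n - p k n))\<^sup>2)"
      by (subst integral_cong_AE[OF _ _ eq]) (auto intro: integral_circle_series_sq s)
    also have "\<dots> = (\<Sum>n=M k..<M (Suc k). (cmod (p (Suc k) n - p k n))\<^sup>2)"
      by (intro suminf_finite) (auto simp: p_def M_def)
    also have "\<dots> = (\<Sum>n=M k..<M (Suc k). (cmod (a n))\<^sup>2)"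
      by (intro sum.cong) (auto simp: p_def)
    finally show "(LINT \<zeta>|circle_measure. (cmod (P (Suc k) \<zeta> - P k \<zeta>))\<^sup>2) \<le> (1/4) ^ k"
      using M by simp
  qed simp
  then have lim: "AE \<zeta> in circle_measure. (\<lambda>k. P k \<zeta>) \<longlonglongrightarrow> F \<zeta>"
  proof eventually_elim
    case (elim \<zeta>)
    then have "summable (\<lambda>k. P (Suc k) \<zeta> - P k \<zeta>)" by (rule summable_norm_cancel)
    then have "convergent (\<lambda>n. P 0 \<zeta> + (\<Sum>k<n. P (Suc k) \<zeta> - P k \<zeta>))"
      by (intro convergent_add convergent_const) (simp add: summable_iff_convergent)
    then show ?case
      using sum_lessThan_telescope[of "\<lambda>k. P k \<zeta>"] by (simp add: F_def convergent_LIMSEQ_iff)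
  qed
  define D where "D r = (\<Sum>n. (cmod (a n))\<^sup>2 * (1 - r ^ n)\<^sup>2)" for r :: real
  have nn: "(\<integral>\<^sup>+ \<zeta>. ennreal ((cmod (f (of_real r * \<zeta>) - F \<zeta>))\<^sup>2) \<partial>circle_measure) \<le> ennreal (D r)"
    if r: "0 \<le> r" "r < 1" for r
  proof -
    define q where "q n = a n * of_real r ^ n" for n
    have qs: "summable (\<lambda>n. cmod (q n))"
      unfolding q_def a_def by (rule summable_taylor_radius[OF d r])
    have Ds: "summable (\<lambda>n. (cmod (a n))\<^sup>2 * (1 - r ^ n)\<^sup>2)"
      by (rule summable_comparison_test'[OF sq])
         (use r in \<open>auto simp: power_le_one intro!: mult_left_le\<close>)
    have bound: "(\<integral>\<^sup>+ \<zeta>. ennreal ((cmod (f (of_real r * \<zeta>) - P k \<zeta>))\<^sup>2) \<partial>circle_measure)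
        \<le> ennreal (D r + (1/4) ^ k)" for k
    proof -
      have s: "summable (\<lambda>n. cmod (q n - p k n))"
        by (rule summable_comparison_test'[OF summable_add[OF qs ps[of k]]]) (simp add: norm_triangle_ineq4)
      have "AE \<zeta> in circle_measure. ennreal ((cmod (f (of_real r * \<zeta>) - P k \<zeta>))\<^sup>2)
          = ennreal ((cmod (circle_series (\<lambda>n. q n - p k n) \<zeta>))\<^sup>2)"
        using AE_circle_norm
        by eventually_elim
           (simp add: P_def circle_series_diff ps qs dilate_eq_circle_series[OF d r] q_def[abs_def] a_def
             summable_taylor_radius[OF d r])
      then have "(\<integral>\<^sup>+ \<zeta>. ennreal ((cmod (f (of_real r * \<zeta>) - P k \<zeta>))\<^sup>2) \<partial>circle_measure)
          = (\<integral>\<^sup>+ \<zeta>. ennreal ((cmod (circle_series (\<lambda>n. q n - p k n) \<zeta>))\<^sup>2) \<partial>circle_measure)"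
        by (rule nn_integral_cong_AE)
      also have "\<dots> = ennreal (\<Sum>n. (cmod (q n - p k n))\<^sup>2)"
        by (subst nn_integral_eq_integral) (auto simp: integral_circle_series_sq s integrable_circle_series_sq)
      also have "(\<Sum>n. (cmod (q n - p k n))\<^sup>2)
          \<le> (\<Sum>n. (cmod (a n))\<^sup>2 * (1 - r ^ n)\<^sup>2 + (if M k \<le> n then (cmod (a n))\<^sup>2 else 0))"
      proof (rule suminf_le)
        show "summable (\<lambda>n. (cmod (a n))\<^sup>2 * (1 - r ^ n)\<^sup>2 + (if M k \<le> n then (cmod (a n))\<^sup>2 else 0))"
          by (intro summable_add Ds summable_comparison_test'[OF sq, of 0 "\<lambda>n. if M k \<le> n then (cmod (a n))\<^sup>2 else 0"]) auto
        show "(cmod (q n - p k n))\<^sup>2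
          \<le> (cmod (a n))\<^sup>2 * (1 - r ^ n)\<^sup>2 + (if M k \<le> n then (cmod (a n))\<^sup>2 else 0)" for n
        proof (cases "M k \<le> n")
          case True
          have "(cmod (q n - p k n))\<^sup>2 = (cmod (a n) * r ^ n)\<^sup>2"
            using True r by (simp add: q_def p_def norm_mult norm_power)
          also have "\<dots> \<le> (cmod (a n))\<^sup>2"
            using r by (intro power_mono mult_left_le power_le_one) auto
          finally show ?thesis using True by (simp add: add_increasing)
        next
          case False
          have "q n - p k n = - (a n * of_real (1 - r ^ n))"
            using False by (simp add: q_def p_def algebra_simps)
          then have "(cmod (q n - p k n))\<^sup>2 = (cmod (a n))\<^sup>2 * (1 - r ^ n)\<^sup>2"
            by (simp only: norm_minus_cancel norm_mult norm_of_real power_mult_distrib power2_abs)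
          then show ?thesis using False by simp
        qed
      qed (intro summable_sq_if_summable s, simp)
      also have "\<dots> = D r + (\<Sum>n. if M k \<le> n then (cmod (a n))\<^sup>2 else 0)"
        unfolding D_def
        by (intro suminf_add[symmetric] Ds
          summable_comparison_test'[OF sq, of 0 "\<lambda>n. if M k \<le> n then (cmod (a n))\<^sup>2 else 0"]) auto
      also have "(\<Sum>n. if M k \<le> n then (cmod (a n))\<^sup>2 else 0) \<le> (1/4) ^ k"
      proof (rule suminf_le_const)
        show "summable (\<lambda>n. if M k \<le> n then (cmod (a n))\<^sup>2 else 0)"
          by (rule summable_comparison_test'[OF sq, of 0]) auto
        fix n
        have "(\<Sum>i<n. if M k \<le> i then (cmod (a i))\<^sup>2 else 0) = (\<Sum>i=M k..<n. (cmod (a i))\<^sup>2)"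
          by (intro sum.mono_neutral_cong_right) auto
        then show "(\<Sum>i<n. if M k \<le> i then (cmod (a i))\<^sup>2 else 0) \<le> (1/4) ^ k"
          using M by simp
      qed
      finally show ?thesis by (simp add: ennreal_leI)
    qed
    have "(\<integral>\<^sup>+ \<zeta>. ennreal ((cmod (f (of_real r * \<zeta>) - F \<zeta>))\<^sup>2) \<partial>circle_measure)
        = (\<integral>\<^sup>+ \<zeta>. liminf (\<lambda>k. ennreal ((cmod (f (of_real r * \<zeta>) - P k \<zeta>))\<^sup>2)) \<partial>circle_measure)"
    proof (rule nn_integral_cong_AE)
      show "AE \<zeta> in circle_measure. ennreal ((cmod (f (of_real r * \<zeta>) - F \<zeta>))\<^sup>2)
          = liminf (\<lambda>k. ennreal ((cmod (f (of_real r * \<zeta>) - P k \<zeta>))\<^sup>2))"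
        using lim
        by eventually_elim (intro lim_imp_Liminf[symmetric] tendsto_intros, auto)
    qed
    also have "\<dots> \<le> liminf (\<lambda>k. \<integral>\<^sup>+ \<zeta>. ennreal ((cmod (f (of_real r * \<zeta>) - P k \<zeta>))\<^sup>2) \<partial>circle_measure)"
      by (rule nn_integral_liminf) simp
    also have "\<dots> \<le> liminf (\<lambda>k. ennreal (D r + (1/4) ^ k))"
      by (intro Liminf_mono always_eventually allI bound)
    also have "\<dots> = ennreal (D r + 0)"
      by (intro lim_imp_Liminf tendsto_ennrealI tendsto_add tendsto_const LIMSEQ_power_zero) auto
    finally show ?thesis by simp
  qed
  have int: "integrable circle_measure (\<lambda>\<zeta>. (cmod (f (of_real r * \<zeta>) - F \<zeta>))\<^sup>2)"
    and le: "(LINT \<zeta>|circle_measure. (cmod (f (of_real r * \<zeta>) - F \<zeta>))\<^sup>2) \<le> D r"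
    if r: "0 \<le> r" "r < 1" for r
  proof -
    show int: "integrable circle_measure (\<lambda>\<zeta>. (cmod (f (of_real r * \<zeta>) - F \<zeta>))\<^sup>2)"
      by (rule integrableI_bounded) (use nn[OF r] in \<open>auto simp: le_less_trans\<close>)
    have "0 \<le> D r" unfolding D_def
      by (rule suminf_nonneg, rule summable_comparison_test'[OF sq])
         (use r in \<open>auto simp: power_le_one intro!: mult_left_le\<close>)
    then show "(LINT \<zeta>|circle_measure. (cmod (f (of_real r * \<zeta>) - F \<zeta>))\<^sup>2) \<le> D r"
      using nn[OF r] by (subst (asm) nn_integral_eq_integral[OF int]) auto
  qed
  have "has_boundary_values f F"
    unfolding has_boundary_values_def
  proof (intro conjI)
    (* Square integrability of F follows from the distance to the dilate of radius 0, a constant. *)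
    have i: "integrable circle_measure (\<lambda>\<zeta>. 2 * (cmod (f 0))\<^sup>2 + 2 * (cmod (f (of_real 0 * \<zeta>) - F \<zeta>))\<^sup>2)"
      using int[of 0] by (intro Bochner_Integration.integrable_add integrable_mult_right) auto
    show "integrable circle_measure (\<lambda>\<zeta>. (cmod (F \<zeta>))\<^sup>2)"
    proof (rule Bochner_Integration.integrable_bound[OF i])
      have "(cmod y)\<^sup>2 \<le> 2 * (cmod x)\<^sup>2 + 2 * (cmod (x - y))\<^sup>2" for x y :: complex
        using cmod_diff_sq_le[of x "x - y"] by simp
      then show "AE \<zeta> in circle_measure. norm ((cmod (F \<zeta>))\<^sup>2)
          \<le> norm (2 * (cmod (f 0))\<^sup>2 + 2 * (cmod (f (of_real 0 * \<zeta>) - F \<zeta>))\<^sup>2)"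
        by simp
    qed simp
    show "((\<lambda>r. LINT \<zeta>|circle_measure. (cmod (f (of_real r * \<zeta>) - F \<zeta>))\<^sup>2) \<longlongrightarrow> 0) (at_left 1)"
    proof (rule tendsto_sandwich[OF _ _ tendsto_const])
      show "(D \<longlongrightarrow> 0) (at_left 1)"
        unfolding D_def by (rule tendsto_dilation_error[OF sq])
    qed (auto intro!: eventually_at_left_1 le)
  qed simp
  then show ?thesis by blast
qed

lemma has_boundary_values_boundary: "f \<in> hardy2 \<Longrightarrow> has_boundary_values f (boundary f)"
  unfolding boundary_def by (rule someI_ex[OF ex_boundary_values])

text \<open>The pairing is continuous for \<open>L\<^sup>2\<close> convergence in both arguments, by Cauchy-Schwarz; this makes
  the inner product independent of the boundary values that are chosen to define it.\<close>

lemma tendsto_integral_dilate_mult_cnj: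
  assumes f: "f \<in> hardy2" and g: "g \<in> hardy2"
  shows "((\<lambda>r. LINT \<zeta>|circle_measure. f (of_real r * \<zeta>) * cnj (g (of_real r * \<zeta>))) \<longlongrightarrow> h2_inner f g)
    (at_left 1)"
proof -
  define F where "F = boundary f"
  define G where "G = boundary g"
  note bF = has_boundary_values_boundary[OF f, folded F_def, unfolded has_boundary_values_def]
  note bG = has_boundary_values_boundary[OF g, folded G_def, unfolded has_boundary_values_def]
  have [measurable]: "F \<in> borel_measurable circle_measure" "G \<in> borel_measurable circle_measure"
    using bF bG by auto
  have [measurable]: "(\<lambda>\<zeta>. f (c * \<zeta>)) \<in> borel_measurable borel" "(\<lambda>\<zeta>. g (c * \<zeta>)) \<in> borel_measurable borel" for c
    using f g by (auto intro: dilate_measurable simp: hardy2_iff)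
  have sq_diff: "integrable circle_measure (\<lambda>\<zeta>. (cmod (u \<zeta> - v \<zeta>))\<^sup>2)"
    if [measurable]: "u \<in> borel_measurable circle_measure" "v \<in> borel_measurable circle_measure"
      and i: "integrable circle_measure (\<lambda>\<zeta>. (cmod (u \<zeta>))\<^sup>2)" "integrable circle_measure (\<lambda>\<zeta>. (cmod (v \<zeta>))\<^sup>2)"
    for u v :: "complex \<Rightarrow> complex"
  proof (rule Bochner_Integration.integrable_bound)
    show "integrable circle_measure (\<lambda>\<zeta>. 2 * (cmod (u \<zeta>))\<^sup>2 + 2 * (cmod (v \<zeta>))\<^sup>2)"
      using i by (intro Bochner_Integration.integrable_add integrable_mult_right) auto
    show "AE \<zeta> in circle_measure. norm ((cmod (u \<zeta> - v \<zeta>))\<^sup>2) \<le> norm (2 * (cmod (u \<zeta>))\<^sup>2 + 2 * (cmod (v \<zeta>))\<^sup>2)"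
      using cmod_diff_sq_le by simp
  qed simp
  define K where "K = sqrt (\<Sum>n. (cmod (taylor_coeff g n))\<^sup>2)"
  define L where "L = sqrt (LINT \<zeta>|circle_measure. (cmod (F \<zeta>))\<^sup>2)"
  define d where "d r = sqrt (LINT \<zeta>|circle_measure. (cmod (f (of_real r * \<zeta>) - F \<zeta>))\<^sup>2)" for r :: real
  define e where "e r = sqrt (LINT \<zeta>|circle_measure. (cmod (g (of_real r * \<zeta>) - G \<zeta>))\<^sup>2)" for r :: real
  have bound: "norm ((LINT \<zeta>|circle_measure. f (of_real r * \<zeta>) * cnj (g (of_real r * \<zeta>))) - h2_inner f g)
      \<le> d r * K + L * e r" if r: "0 \<le> r" "r < 1" for r
  proof -
    let ?f = "\<lambda>\<zeta>. f (of_real r * \<zeta>)" and ?g = "\<lambda>\<zeta>. g (of_real r * \<zeta>)"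
    have fi: "integrable circle_measure (\<lambda>\<zeta>. (cmod (?f \<zeta>))\<^sup>2)"
      and gi: "integrable circle_measure (\<lambda>\<zeta>. (cmod (?g \<zeta>))\<^sup>2)"
      and Fi: "integrable circle_measure (\<lambda>\<zeta>. (cmod (F \<zeta>))\<^sup>2)"
      and Gi: "integrable circle_measure (\<lambda>\<zeta>. (cmod (G \<zeta>))\<^sup>2)"
      using bF bG f g r by (auto simp: hardy2_iff integrable_dilate_sq)
    have fFi: "integrable circle_measure (\<lambda>\<zeta>. (cmod (?f \<zeta> - F \<zeta>))\<^sup>2)"
      and gGi: "integrable circle_measure (\<lambda>\<zeta>. (cmod (?g \<zeta> - G \<zeta>))\<^sup>2)"
      by (intro sq_diff fi gi Fi Gi; simp)+
    have "(LINT \<zeta>|circle_measure. ?f \<zeta> * cnj (?g \<zeta>)) - h2_inner f g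
        = (LINT \<zeta>|circle_measure. ?f \<zeta> * cnj (?g \<zeta>) - F \<zeta> * cnj (G \<zeta>))"
      unfolding h2_inner_def F_def[symmetric] G_def[symmetric]
      by (intro Bochner_Integration.integral_diff[symmetric] integrable_mult_cnj fi gi Fi Gi) auto
    also have "\<dots> = (LINT \<zeta>|circle_measure. (?f \<zeta> - F \<zeta>) * cnj (?g \<zeta>) + F \<zeta> * cnj (?g \<zeta> - G \<zeta>))"
      by (intro Bochner_Integration.integral_cong) (auto simp: algebra_simps)
    also have "\<dots> = (LINT \<zeta>|circle_measure. (?f \<zeta> - F \<zeta>) * cnj (?g \<zeta>))
        + (LINT \<zeta>|circle_measure. F \<zeta> * cnj (?g \<zeta> - G \<zeta>))"
      by (intro Bochner_Integration.integral_add integrable_mult_cnj fi gi Fi Gi fFi gGi) auto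
    also have "norm \<dots> \<le> d r * sqrt (LINT \<zeta>|circle_measure. (cmod (?g \<zeta>))\<^sup>2) + L * e r"
      unfolding d_def L_def e_def
      by (intro norm_triangle_mono cmod_integral_mult_cnj fi gi Fi Gi fFi gGi) auto
    also have "\<dots> \<le> d r * K + L * e r"
      unfolding K_def
      by (intro add_mono mult_left_mono real_sqrt_le_mono integral_dilate_sq_le r)
         (use g in \<open>auto simp: d_def L_def hardy2_iff\<close>)
    finally show ?thesis .
  qed
  have dl: "(d \<longlongrightarrow> 0) (at_left 1)" and el: "(e \<longlongrightarrow> 0) (at_left 1)"
    unfolding d_def e_def using bF bG by (auto intro: tendsto_eq_intros)
  have "((\<lambda>r. d r * K + L * e r) \<longlongrightarrow> 0) (at_left 1)"
    by (rule tendsto_eq_intros dl el refl | simp)+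
  then show ?thesis
    by (rule Lim_transform_bound[THEN Lim_null[THEN iffD2], rotated])
       (auto intro!: eventually_at_left_1 order_trans[OF bound abs_ge_self])
qed

lemma summable_mult_if_sq:
  fixes a b :: "nat \<Rightarrow> complex"
  assumes "summable (\<lambda>n. (cmod (a n))\<^sup>2)" "summable (\<lambda>n. (cmod (b n))\<^sup>2)"
  shows "summable (\<lambda>n. cmod (a n) * cmod (b n))"
proof (rule summable_comparison_test'[OF summable_add[OF assms]])
  fix n
  have "0 \<le> cmod (a n) * cmod (b n)" by simp
  then show "norm (cmod (a n) * cmod (b n)) \<le> (cmod (a n))\<^sup>2 + (cmod (b n))\<^sup>2"
    using sum_squares_bound[of "cmod (a n)" "cmod (b n)"] unfolding real_norm_def by linarith
qed

text \<open>Both sides are the limit of the inner products of the dilates. From here on the Hardy space can be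
  treated as the space of square-summable sequences.\<close>

theorem h2_inner_eq:
  assumes f: "f \<in> hardy2" and g: "g \<in> hardy2"
  shows "h2_inner f g = (\<Sum>n. taylor_coeff f n * cnj (taylor_coeff g n))"
proof (rule tendsto_unique[OF _ tendsto_integral_dilate_mult_cnj[OF f g]])
  have "((\<lambda>r. \<Sum>n. taylor_coeff f n * cnj (taylor_coeff g n) * of_real (r ^ (2 * n)))
      \<longlongrightarrow> (\<Sum>n. taylor_coeff f n * cnj (taylor_coeff g n))) (at_left 1)"
  proof (rule tendsto_suminf_dominated[where A = "{0..<1}"
        and M = "\<lambda>n. cmod (taylor_coeff f n) * cmod (taylor_coeff g n)"])
    show "((\<lambda>r. taylor_coeff f n * cnj (taylor_coeff g n) * of_real (r ^ (2 * n)))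
        \<longlongrightarrow> taylor_coeff f n * cnj (taylor_coeff g n)) (at_left 1)" for n
      by (rule tendsto_eq_intros refl | simp)+
    show "norm (taylor_coeff f n * cnj (taylor_coeff g n) * of_real (r ^ (2 * n)))
        \<le> cmod (taylor_coeff f n) * cmod (taylor_coeff g n)" if "r \<in> {0..<1}" for n r
      using that by (auto simp: norm_mult norm_power intro!: mult_left_le power_le_one)
  qed (use f g in \<open>auto intro!: eventually_at_left_1 summable_mult_if_sq simp: hardy2_iff\<close>)
  then show "((\<lambda>r. LINT \<zeta>|circle_measure. f (of_real r * \<zeta>) * cnj (g (of_real r * \<zeta>)))
      \<longlongrightarrow> (\<Sum>n. taylor_coeff f n * cnj (taylor_coeff g n))) (at_left 1)"
    by (rule Lim_transform_eventually)
       (use f g in \<open>auto intro!: eventually_at_left_1 simp: hardy2_iff integral_dilate_mult_cnj\<close>)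
qed simp

section \<open>Shifts and monomials in the Hardy space\<close>

lemma disc_holo_ext:
  assumes "f \<in> disc_holo" "g \<in> disc_holo" "\<And>n. taylor_coeff f n = taylor_coeff g n"
  shows "f = g"
proof
  fix z
  show "f z = g z"
  proof (cases "z \<in> unit_disc")
    case True
    have "(\<lambda>n. taylor_coeff f n * z ^ n) sums f z" "(\<lambda>n. taylor_coeff f n * z ^ n) sums g z"
      using sums_taylor[of f z] sums_taylor[of g z] True assms by (auto simp: disc_holo_def)
    then show ?thesis by (rule sums_unique2)
  qed (use assms in \<open>auto simp: disc_holo_def\<close>)
qed

text \<open>The way to place a function in the Hardy space: exhibit a square-summable expansion, which then
  is its sequence of Taylor coefficients.\<close>

lemma hardy2_seriesI:
  assumes 0: "\<And>z. z \<notin> unit_disc \<Longrightarrow> f z = 0"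
    and sums: "\<And>z. z \<in> unit_disc \<Longrightarrow> (\<lambda>n. a n * z ^ n) sums f z"
    and sq: "summable (\<lambda>n. (cmod (a n))\<^sup>2)"
  shows "f \<in> hardy2" and "taylor_coeff f = a"
proof -
  show tc: "taylor_coeff f = a" by (rule taylor_coeff_eqI[OF sums])
  have "f holomorphic_on unit_disc"
    using sums by (intro power_series_holomorphic[where a = a]) auto
  then show "f \<in> hardy2" using 0 sq by (auto simp: hardy2_iff tc disc_holo_def)
qed

lemma hardy2_taylor:
  assumes "f \<in> hardy2"
  shows "z \<notin> unit_disc \<Longrightarrow> f z = 0"
    and "z \<in> unit_disc \<Longrightarrow> (\<lambda>n. taylor_coeff f n * z ^ n) sums f z"
    and "summable (\<lambda>n. (cmod (taylor_coeff f n))\<^sup>2)"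
  using assms by (auto simp: hardy2_iff disc_holo_def intro: sums_taylor)

lemma hardy2_imp_disc_holo: "f \<in> hardy2 \<Longrightarrow> f \<in> disc_holo"
  by (simp add: hardy2_iff)

lemma hardy2_ext:
  "f \<in> hardy2 \<Longrightarrow> g \<in> hardy2 \<Longrightarrow> (\<And>n. taylor_coeff f n = taylor_coeff g n) \<Longrightarrow> f = g"
  by (intro disc_holo_ext) (auto simp: hardy2_iff)

lemma summable_sq_add:
  fixes a b :: "nat \<Rightarrow> complex"
  assumes "summable (\<lambda>n. (cmod (a n))\<^sup>2)" "summable (\<lambda>n. (cmod (b n))\<^sup>2)"
  shows "summable (\<lambda>n. (cmod (a n + b n))\<^sup>2)"
proof (rule summable_comparison_test'[OF summable_mult[OF summable_add[OF assms], of 2], of 0])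
  show "norm ((cmod (a n + b n))\<^sup>2) \<le> 2 * ((cmod (a n))\<^sup>2 + (cmod (b n))\<^sup>2)" for n
    using cmod_diff_sq_le[of "a n" "- b n"] by simp
qed

lemma
  assumes "f \<in> hardy2" "g \<in> hardy2"
  shows hardy2_add: "f + g \<in> hardy2"
    and taylor_coeff_add: "taylor_coeff (f + g) = (\<lambda>n. taylor_coeff f n + taylor_coeff g n)"
proof -
  have 1: "(f + g) z = 0" if "z \<notin> unit_disc" for z
    using that assms by (simp add: hardy2_taylor)
  have 2: "(\<lambda>n. (taylor_coeff f n + taylor_coeff g n) * z ^ n) sums (f + g) z" if "z \<in> unit_disc" for z
    using sums_add[OF assms[THEN hardy2_taylor(2), OF that]] by (simp add: algebra_simps)
  note * = hardy2_seriesI[OF 1 2 summable_sq_add[OF assms[THEN hardy2_taylor(3)]]]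
  show "f + g \<in> hardy2" "taylor_coeff (f + g) = (\<lambda>n. taylor_coeff f n + taylor_coeff g n)"
    by (rule *; simp)+
qed

lemma
  assumes "f \<in> hardy2"
  shows hardy2_cscale: "cscale c f \<in> hardy2"
    and taylor_coeff_cscale: "taylor_coeff (cscale c f) = (\<lambda>n. c * taylor_coeff f n)"
proof -
  have 1: "cscale c f z = 0" if "z \<notin> unit_disc" for z
    using that assms by (simp add: hardy2_taylor cscale_def)
  have 2: "(\<lambda>n. (c * taylor_coeff f n) * z ^ n) sums cscale c f z" if "z \<in> unit_disc" for z
    using sums_mult[OF assms[THEN hardy2_taylor(2), OF that], of c] by (simp add: cscale_def mult_ac)
  have 3: "summable (\<lambda>n. (cmod (c * taylor_coeff f n))\<^sup>2)"
    using hardy2_taylor(3)[OF assms] by (simp add: norm_mult power_mult_distrib summable_mult)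
  show "cscale c f \<in> hardy2" "taylor_coeff (cscale c f) = (\<lambda>n. c * taylor_coeff f n)"
    by (rule hardy2_seriesI[OF 1 2 3]; simp)+
qed

lemma zero_in_hardy2: "0 \<in> hardy2"
  by (rule hardy2_seriesI[where a = "\<lambda>_. 0"]) auto

lemma subspace_hardy2: "cfun.subspace hardy2"
  by (rule cfun.subspaceI) (auto intro: hardy2_add hardy2_cscale zero_in_hardy2)

lemma
  assumes "f \<in> hardy2" "g \<in> hardy2"
  shows hardy2_diff: "f - g \<in> hardy2"
    and taylor_coeff_diff: "taylor_coeff (f - g) = (\<lambda>n. taylor_coeff f n - taylor_coeff g n)"
proof -
  have *: "f - g = f + cscale (-1) g" by (auto simp: cscale_def fun_eq_iff)
  show "f - g \<in> hardy2" unfolding * by (intro hardy2_add hardy2_cscale assms)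
  show "taylor_coeff (f - g) = (\<lambda>n. taylor_coeff f n - taylor_coeff g n)"
    by (simp only: * taylor_coeff_add[OF assms(1) hardy2_cscale[OF assms(2)]]
      taylor_coeff_cscale[OF assms(2)]) simp
qed

lemma
  assumes "f \<in> hardy2"
  shows hardy2_shift: "shift f \<in> hardy2"
    and taylor_coeff_shift: "taylor_coeff (shift f) = case_nat 0 (taylor_coeff f)"
proof -
  have 1: "shift f z = 0" if "z \<notin> unit_disc" for z
    using that assms by (simp add: hardy2_taylor shift_def)
  have 2: "(\<lambda>n. case_nat 0 (taylor_coeff f) n * z ^ n) sums shift f z" if "z \<in> unit_disc" for z
    using sums_mult[OF assms[THEN hardy2_taylor(2), OF that], of z]
      sums_Suc_iff[of "\<lambda>n. case_nat 0 (taylor_coeff f) n * z ^ n" "shift f z"]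
    by (simp add: shift_def mult_ac)
  have 3: "summable (\<lambda>n. (cmod (case_nat 0 (taylor_coeff f) n))\<^sup>2)"
    using hardy2_taylor(3)[OF assms] by (subst summable_Suc_iff[symmetric]) simp
  show "shift f \<in> hardy2" "taylor_coeff (shift f) = case_nat 0 (taylor_coeff f)"
    by (rule hardy2_seriesI[OF 1 2 3]; simp)+
qed

lemma
  assumes "f \<in> hardy2"
  shows hardy2_backward_shift: "backward_shift f \<in> hardy2"
    and taylor_coeff_backward_shift: "taylor_coeff (backward_shift f) = (\<lambda>n. taylor_coeff f (Suc n))"
proof -
  have 1: "backward_shift f z = 0" if "z \<notin> unit_disc" for z
    using that by (simp add: backward_shift_def)
  have 2: "(\<lambda>n. taylor_coeff f (Suc n) * z ^ n) sums backward_shift f z" if "z \<in> unit_disc" for z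
  proof (cases "z = 0")
    case True
    have "(\<lambda>n. taylor_coeff f (Suc n) * 0 ^ n) sums taylor_coeff f (Suc 0)"
      using powser_sums_zero[of "\<lambda>n. taylor_coeff f (Suc n)"] by simp
    then show ?thesis using True by (simp add: backward_shift_def taylor_coeff_def)
  next
    case False
    have f0: "f 0 = taylor_coeff f 0" by (simp add: taylor_coeff_def)
    have "(\<lambda>n. taylor_coeff f (Suc n) * z ^ Suc n) sums (f z - f 0)"
      using hardy2_taylor(2)[OF assms that] sums_Suc_iff[of "\<lambda>n. taylor_coeff f n * z ^ n" "f z - f 0"]
      by (simp add: f0)
    from sums_divide[OF this, of z] show ?thesis
      using False that by (simp add: backward_shift_def mult_ac)
  qed
  have 3: "summable (\<lambda>n. (cmod (taylor_coeff f (Suc n)))\<^sup>2)"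
    using hardy2_taylor(3)[OF assms] by (subst summable_Suc_iff)
  show "backward_shift f \<in> hardy2" "taylor_coeff (backward_shift f) = (\<lambda>n. taylor_coeff f (Suc n))"
    by (rule hardy2_seriesI[OF 1 2 3]; simp)+
qed

text \<open>Hardy space elements are extended by \<open>0\<close>, so a monomial must be cut off at the edge of the disc
  to be one of them.\<close>

definition disc_power :: "nat \<Rightarrow> complex \<Rightarrow> complex" where
  "disc_power n z = (if z \<in> unit_disc then z ^ n else 0)"

lemma
  shows hardy2_disc_power: "disc_power n \<in> hardy2"
    and taylor_coeff_disc_power: "taylor_coeff (disc_power n) = (\<lambda>m. if m = n then 1 else 0)"
proof -
  have 2: "(\<lambda>m. (if m = n then 1 else 0) * z ^ m) sums disc_power n z" if "z \<in> unit_disc" for z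
  proof -
    have "(\<lambda>m. (if m = n then 1 else 0) * z ^ m) = (\<lambda>m. if m = n then z ^ m else 0)" by auto
    then show ?thesis using that sums_single[of n "\<lambda>m. z ^ m"] by (simp add: disc_power_def)
  qed
  have 3: "summable (\<lambda>m. (cmod (if m = n then 1 else 0))\<^sup>2)"
    by (rule summable_finite[of "{n}"]) auto
  show "disc_power n \<in> hardy2" "taylor_coeff (disc_power n) = (\<lambda>m. if m = n then 1 else 0)"
    by (rule hardy2_seriesI[OF _ 2 3]; simp add: disc_power_def)+
qed

section \<open>The inner product in terms of coefficients\<close>

lemma summable_h2_inner:
  assumes "f \<in> hardy2" "g \<in> hardy2"
  shows "summable (\<lambda>n. taylor_coeff f n * cnj (taylor_coeff g n))"
  by (rule summable_norm_cancel)
     (use summable_mult_if_sq[OF assms[THEN hardy2_taylor(3)]] in \<open>simp add: norm_mult\<close>)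

lemma h2_inner_cscale_left:
  assumes "f \<in> hardy2" "h \<in> hardy2"
  shows "h2_inner (cscale c f) h = c * h2_inner f h"
  using assms
  by (simp add: h2_inner_eq hardy2_cscale taylor_coeff_cscale mult.assoc suminf_mult summable_h2_inner)

lemma h2_inner_diff_left:
  assumes "f \<in> hardy2" "g \<in> hardy2" "h \<in> hardy2"
  shows "h2_inner (f - g) h = h2_inner f h - h2_inner g h"
  using assms
  by (simp add: h2_inner_eq hardy2_diff taylor_coeff_diff left_diff_distrib suminf_diff summable_h2_inner)

lemma h2_inner_add_right:
  assumes "f \<in> hardy2" "g \<in> hardy2" "h \<in> hardy2"
  shows "h2_inner h (f + g) = h2_inner h f + h2_inner h g"
  using assms
  by (simp add: h2_inner_eq hardy2_add taylor_coeff_add distrib_left suminf_add summable_h2_inner)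

lemma h2_inner_cscale_right:
  assumes "f \<in> hardy2" "h \<in> hardy2"
  shows "h2_inner h (cscale c f) = cnj c * h2_inner h f"
  using assms
  by (simp add: h2_inner_eq hardy2_cscale taylor_coeff_cscale mult.left_commute suminf_mult summable_h2_inner)

lemma h2_inner_self:
  assumes "f \<in> hardy2"
  shows "h2_inner f f = of_real (\<Sum>n. (cmod (taylor_coeff f n))\<^sup>2)"
  by (simp only: h2_inner_eq[OF assms assms] suminf_of_real[OF hardy2_taylor(3)[OF assms]] complex_norm_square)

lemma cmod_taylor_coeff_le_h2_norm:
  assumes "f \<in> hardy2"
  shows "cmod (taylor_coeff f n) \<le> h2_norm f"
proof -
  have "(cmod (taylor_coeff f n))\<^sup>2 \<le> (\<Sum>n. (cmod (taylor_coeff f n))\<^sup>2)"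
    using sum_le_suminf[OF hardy2_taylor(3)[OF assms], of "{n}"] by simp
  then show ?thesis
    by (simp add: h2_norm_def h2_inner_self[OF assms] real_le_rsqrt)
qed

lemma h2_inner_self_eq_0:
  assumes "f \<in> hardy2" "h2_inner f f = 0"
  shows "f = 0"
proof (rule hardy2_ext[OF assms(1) zero_in_hardy2])
  fix n
  have "taylor_coeff f n = 0"
    using cmod_taylor_coeff_le_h2_norm[OF assms(1), of n] assms(2) by (simp add: h2_norm_def)
  moreover have "taylor_coeff 0 n = 0"
    using taylor_coeff_cscale[OF zero_in_hardy2, of 0] by (simp add: cscale_def zero_fun_def)
  ultimately show "taylor_coeff f n = taylor_coeff 0 n" by simp
qed

text \<open>The backward shift is the adjoint of the shift: on coefficients, the summation index moves by one.\<close>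

lemma h2_inner_backward_shift:
  assumes "f \<in> hardy2" "g \<in> hardy2"
  shows "h2_inner (backward_shift f) g = h2_inner f (shift g)"
proof -
  have "(\<Sum>n. taylor_coeff f n * cnj (taylor_coeff (shift g) n))
      = (\<Sum>n. taylor_coeff f (Suc n) * cnj (taylor_coeff g n))"
    using suminf_split_head[OF summable_h2_inner[OF assms(1) hardy2_shift[OF assms(2)]]]
    by (simp add: taylor_coeff_shift assms)
  then show ?thesis
    using assms by (simp add: h2_inner_eq hardy2_backward_shift hardy2_shift taylor_coeff_backward_shift)
qed

lemma h2_inner_shift_shift:
  assumes "f \<in> hardy2" "g \<in> hardy2"
  shows "h2_inner (shift f) (shift g) = h2_inner f g"
proof -
  have "backward_shift (shift f) = f"
    using assms
    by (intro hardy2_ext) (auto simp: hardy2_backward_shift hardy2_shift taylor_coeff_backward_shift taylor_coeff_shift)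
  then show ?thesis
    using h2_inner_backward_shift[OF hardy2_shift[OF assms(1)] assms(2)] by simp
qed

lemma hardy2_decompose:
  assumes "h \<in> hardy2"
  shows "h = cscale (h 0) (disc_power 0) + shift (backward_shift h)"
  using hardy2_taylor(1)[OF assms]
  by (auto simp: fun_eq_iff cscale_def disc_power_def shift_def backward_shift_def)

section \<open>Multiplication by an inner function\<close>

locale inner_symbol =
  fixes \<theta> :: "complex \<Rightarrow> complex"
  assumes inner: "inner_function \<theta>"
begin

definition mul_theta :: "(complex \<Rightarrow> complex) \<Rightarrow> complex \<Rightarrow> complex" where
  "mul_theta h = (\<lambda>z. \<theta> z * h z)"

text \<open>The Hardy space element given by \<open>\<theta>\<close>, whose own values off the disc are arbitrary.\<close>

definition theta0 :: "complex \<Rightarrow> complex" where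
  "theta0 = mul_theta (disc_power 0)"

lemma bounded_theta: obtains C where "0 \<le> C" "\<And>z. z \<in> unit_disc \<Longrightarrow> cmod (\<theta> z) \<le> C"
proof -
  obtain C where "\<And>z. z \<in> unit_disc \<Longrightarrow> cmod (\<theta> z) \<le> C"
    using inner unfolding inner_function_def bounded_iff by blast
  moreover have "0 \<le> C" using norm_ge_zero calculation[of 0] by (rule order_trans) simp
  ultimately show ?thesis using that by blast
qed

lemma holo_theta: "\<theta> holomorphic_on unit_disc"
  using inner by (simp add: inner_function_def)

lemma hardy2_mul_theta:
  assumes h: "h \<in> hardy2" shows "mul_theta h \<in> hardy2"
proof -
  obtain C where C: "0 \<le> C" "\<And>z. z \<in> unit_disc \<Longrightarrow> cmod (\<theta> z) \<le> C" using bounded_theta by blast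
  have hd: "h \<in> disc_holo" using h by (simp add: hardy2_iff)
  have md: "mul_theta h \<in> disc_holo"
    using hd holo_theta by (auto simp: disc_holo_def mul_theta_def intro!: holomorphic_intros)
  have pt: "(cmod (mul_theta h z))\<^sup>2 \<le> C\<^sup>2 * (cmod (h z))\<^sup>2" for z
  proof (cases "z \<in> unit_disc")
    case True
    then have "cmod (mul_theta h z) \<le> C * cmod (h z)"
      using C by (simp add: mul_theta_def norm_mult mult_right_mono)
    then have "(cmod (mul_theta h z))\<^sup>2 \<le> (C * cmod (h z))\<^sup>2" by (intro power_mono) auto
    then show ?thesis by (simp add: power_mult_distrib)
  qed (use md in \<open>auto simp: disc_holo_def\<close>)
  have "(LINT \<zeta>|circle_measure. (cmod (mul_theta h (of_real r * \<zeta>)))\<^sup>2)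
      \<le> C\<^sup>2 * (\<Sum>n. (cmod (taylor_coeff h n))\<^sup>2)" if r: "0 \<le> r" "r < 1" for r
  proof -
    have "(LINT \<zeta>|circle_measure. (cmod (mul_theta h (of_real r * \<zeta>)))\<^sup>2)
        \<le> (LINT \<zeta>|circle_measure. C\<^sup>2 * (cmod (h (of_real r * \<zeta>)))\<^sup>2)"
      by (intro integral_mono integrable_mult_right integrable_dilate_sq hd md r pt)
    also have "\<dots> = C\<^sup>2 * (LINT \<zeta>|circle_measure. (cmod (h (of_real r * \<zeta>)))\<^sup>2)" by simp
    also have "\<dots> \<le> C\<^sup>2 * (\<Sum>n. (cmod (taylor_coeff h n))\<^sup>2)"
      by (intro mult_left_mono integral_dilate_sq_le hd r hardy2_taylor h) auto
    finally show ?thesis .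
  qed
  then show ?thesis
    using md by (auto simp: hardy2_def disc_holo_def intro!: exI[of _ "C\<^sup>2 * (\<Sum>n. (cmod (taylor_coeff h n))\<^sup>2)"])
qed

lemma hardy2_theta0: "theta0 \<in> hardy2"
  by (simp add: theta0_def hardy2_mul_theta hardy2_disc_power)

lemma theta0_eq: "z \<in> unit_disc \<Longrightarrow> theta0 z = \<theta> z"
  by (simp add: theta0_def mul_theta_def disc_power_def)

text \<open>The circle has positive measure, so some radial limit of modulus \<open>1\<close> exists; it cannot be the limit of
  zeros.\<close>

lemma theta0_nonzero: obtains a where "a \<in> unit_disc" "\<theta> a \<noteq> 0"
proof -
  have "AE \<zeta> in circle_measure. cmod \<zeta> = 1 \<and>
        (\<exists>w. ((\<lambda>r. \<theta> (of_real r * \<zeta>)) \<longlongrightarrow> w) (at_left 1) \<and> cmod w = 1)"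
    using inner AE_circle_norm by (auto simp: inner_function_def)
  then obtain \<zeta> w where *: "cmod \<zeta> = 1" "((\<lambda>r. \<theta> (of_real r * \<zeta>)) \<longlongrightarrow> w) (at_left 1)" "cmod w = 1"
    using eventually_happens'[OF circle.ae_filter_bot] by blast
  have "\<exists>a\<in>unit_disc. \<theta> a \<noteq> 0"
  proof (rule ccontr)
    assume "\<not> ?thesis"
    then have "eventually (\<lambda>r. \<theta> (of_real r * \<zeta>) = 0) (at_left 1)"
      using *(1) by (intro eventually_at_left_1) (auto simp: norm_mult)
    then have "((\<lambda>r. \<theta> (of_real r * \<zeta>)) \<longlongrightarrow> 0) (at_left 1)"
      by (rule tendsto_eventually)
    from tendsto_unique[OF _ this *(2)] show False using *(3) by simp
  qed
  then show ?thesis using that by blast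
qed

text \<open>A constant majorant, for dominated convergence as well as for integrability at a fixed radius.\<close>

lemma modulus_defect_bounded:
  obtains B where "\<And>z. z \<in> unit_disc \<Longrightarrow> ((cmod (theta0 z))\<^sup>2 - 1)\<^sup>2 \<le> B"
proof -
  obtain C where C: "0 \<le> C" "\<And>z. z \<in> unit_disc \<Longrightarrow> cmod (\<theta> z) \<le> C" using bounded_theta by blast
  have "((cmod (theta0 z))\<^sup>2 - 1)\<^sup>2 \<le> (C\<^sup>2 + 1)\<^sup>2" if z: "z \<in> unit_disc" for z
  proof -
    have "cmod (theta0 z) \<le> C" using z C by (simp add: theta0_eq)
    then have "(cmod (theta0 z))\<^sup>2 \<le> C\<^sup>2" by (intro power_mono) auto
    then have "\<bar>(cmod (theta0 z))\<^sup>2 - 1\<bar> \<le> \<bar>C\<^sup>2 + 1\<bar>"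
      using zero_le_power2[of "cmod (theta0 z)"] zero_le_power2[of C] by linarith
    then show ?thesis by (simp only: abs_le_square_iff)
  qed
  then show ?thesis using that by blast
qed

text \<open>The dilates of \<open>\<theta>\<close> are bounded and their moduli tend to \<open>1\<close> almost everywhere on the circle, so
  dominated convergence applies along every sequence of radii.\<close>

lemma tendsto_modulus_defect:
  "((\<lambda>r. LINT \<zeta>|circle_measure. ((cmod (theta0 (of_real r * \<zeta>)))\<^sup>2 - 1)\<^sup>2) \<longlongrightarrow> 0) (at_left 1)"
proof (rule tendsto_at_left_sequentially[of 0])
  fix S :: "nat \<Rightarrow> real"
  assume S: "\<And>n. S n < 1" "\<And>n. 0 < S n" "S \<longlonglongrightarrow> 1"
  obtain B where B: "\<And>z. z \<in> unit_disc \<Longrightarrow> ((cmod (theta0 z))\<^sup>2 - 1)\<^sup>2 \<le> B"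
    using modulus_defect_bounded by blast
  have [measurable]: "(\<lambda>\<zeta>. theta0 (c * \<zeta>)) \<in> borel_measurable borel" for c
    by (intro dilate_measurable hardy2_imp_disc_holo hardy2_theta0)
  have "(\<lambda>n. LINT \<zeta>|circle_measure. ((cmod (theta0 (of_real (S n) * \<zeta>)))\<^sup>2 - 1)\<^sup>2)
      \<longlonglongrightarrow> (LINT \<zeta>|circle_measure. 0)"
  proof (rule integral_dominated_convergence)
    show "AE \<zeta> in circle_measure. (\<lambda>n. ((cmod (theta0 (of_real (S n) * \<zeta>)))\<^sup>2 - 1)\<^sup>2) \<longlonglongrightarrow> 0"
      using inner[unfolded inner_function_def, THEN conjunct2, THEN conjunct2] AE_circle_norm
    proof eventually_elim
      case (elim \<zeta>)
      then obtain w where w: "((\<lambda>r. \<theta> (of_real r * \<zeta>)) \<longlongrightarrow> w) (at_left 1)" "cmod w = 1" by blast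
      have "filterlim S (at_left 1) sequentially"
        using S by (auto simp: filterlim_at intro!: always_eventually less_imp_neq)
      then have "(\<lambda>n. \<theta> (of_real (S n) * \<zeta>)) \<longlonglongrightarrow> w"
        by (rule filterlim_compose[OF w(1)])
      then have "(\<lambda>n. theta0 (of_real (S n) * \<zeta>)) \<longlonglongrightarrow> w"
        using S elim by (simp add: theta0_eq norm_mult less_imp_le)
      then have "(\<lambda>n. ((cmod (theta0 (of_real (S n) * \<zeta>)))\<^sup>2 - 1)\<^sup>2) \<longlonglongrightarrow> ((cmod w)\<^sup>2 - 1)\<^sup>2"
        by (intro tendsto_intros)
      then show ?case using w(2) by simp
    qed
    show "AE \<zeta> in circle_measure. norm (((cmod (theta0 (of_real (S n) * \<zeta>)))\<^sup>2 - 1)\<^sup>2) \<le> B" for n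
      using AE_circle_norm by eventually_elim (use S B in \<open>simp add: norm_mult less_imp_le\<close>)
  qed auto
  then show "(\<lambda>n. LINT \<zeta>|circle_measure. ((cmod (theta0 (of_real (S n) * \<zeta>)))\<^sup>2 - 1)\<^sup>2) \<longlonglongrightarrow> 0"
    by simp
qed simp

text \<open>Since \<open>\<bar>\<theta>\<bar> = 1\<close> on the circle, the inner product ought to be that of \<open>1\<close> and \<open>z h\<close>, which vanishes.
  At radius \<open>r\<close> the error is the pairing of \<open>\<bar>\<theta>\<bar>\<^sup>2 - 1\<close> with \<open>z h\<close>, which tends to \<open>0\<close> by
  Cauchy-Schwarz.\<close>

lemma theta_orthogonal_shift:
  assumes h: "h \<in> hardy2"
  shows "h2_inner theta0 (shift (mul_theta h)) = 0"
proof (rule tendsto_unique[OF _ tendsto_integral_dilate_mult_cnj[OF hardy2_theta0 hardy2_shift[OF hardy2_mul_theta[OF h]]]])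
  define s where "s = shift h"
  have s: "s \<in> hardy2" by (simp add: s_def hardy2_shift h)
  note dh = hardy2_theta0[THEN hardy2_imp_disc_holo] s[THEN hardy2_imp_disc_holo]
  have [measurable]: "(\<lambda>\<zeta>. theta0 (c * \<zeta>)) \<in> borel_measurable borel"
    "(\<lambda>\<zeta>. s (c * \<zeta>)) \<in> borel_measurable borel"
    "(\<lambda>\<zeta>. shift (mul_theta h) (c * \<zeta>)) \<in> borel_measurable borel"
    "(\<lambda>\<zeta>. disc_power 0 (c * \<zeta>)) \<in> borel_measurable borel" for c
    by (intro dilate_measurable dh hardy2_imp_disc_holo hardy2_shift hardy2_mul_theta h hardy2_disc_power)+
  obtain B where B: "\<And>z. z \<in> unit_disc \<Longrightarrow> ((cmod (theta0 z))\<^sup>2 - 1)\<^sup>2 \<le> B"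
    using modulus_defect_bounded by blast
  define K where "K = sqrt (\<Sum>n. (cmod (taylor_coeff s n))\<^sup>2)"
  define e where "e r = sqrt (LINT \<zeta>|circle_measure. ((cmod (theta0 (of_real r * \<zeta>)))\<^sup>2 - 1)\<^sup>2)" for r :: real
  have bound: "norm (LINT \<zeta>|circle_measure. theta0 (of_real r * \<zeta>) * cnj (shift (mul_theta h) (of_real r * \<zeta>)))
      \<le> e r * K" if r: "0 \<le> r" "r < 1" for r
  proof -
    let ?u = "\<lambda>\<zeta>. complex_of_real ((cmod (theta0 (of_real r * \<zeta>)))\<^sup>2 - 1)"
    let ?one = "\<lambda>\<zeta>. disc_power 0 (of_real r * \<zeta>)"
    let ?s = "\<lambda>\<zeta>. s (of_real r * \<zeta>)"
    have ui: "integrable circle_measure (\<lambda>\<zeta>. (cmod (?u \<zeta>))\<^sup>2)"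
    proof (rule circle.integrable_const_bound)
      show "AE \<zeta> in circle_measure. norm ((cmod (?u \<zeta>))\<^sup>2) \<le> B"
        using AE_circle_norm
        by eventually_elim (simp only: norm_of_real power2_abs real_norm_def abs_power2, use r B in \<open>simp add: norm_mult\<close>)
    qed simp
    have si: "integrable circle_measure (\<lambda>\<zeta>. (cmod (?s \<zeta>))\<^sup>2)"
      by (rule integrable_dilate_sq[OF dh(2) r])
    have oi: "integrable circle_measure (\<lambda>\<zeta>. (cmod (?one \<zeta>))\<^sup>2)"
      by (rule integrable_dilate_sq[OF hardy2_imp_disc_holo[OF hardy2_disc_power] r])
    have "taylor_coeff (disc_power 0) n * cnj (taylor_coeff s n) = 0" for n
      by (auto simp: taylor_coeff_disc_power s_def taylor_coeff_shift h)
    then have zero: "(LINT \<zeta>|circle_measure. ?one \<zeta> * cnj (?s \<zeta>)) = 0"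
      by (simp only: integral_dilate_mult_cnj[OF hardy2_imp_disc_holo[OF hardy2_disc_power] dh(2) r]
          mult_zero_left suminf_zero)
    have "AE \<zeta> in circle_measure. theta0 (of_real r * \<zeta>) * cnj (shift (mul_theta h) (of_real r * \<zeta>))
        = ?u \<zeta> * cnj (?s \<zeta>) + ?one \<zeta> * cnj (?s \<zeta>)"
      using AE_circle_norm
    proof eventually_elim
      case (elim \<zeta>)
      define z where "z = of_real r * \<zeta>"
      have z: "z \<in> unit_disc" using elim r by (simp add: z_def norm_mult)
      have "theta0 z * cnj (shift (mul_theta h) z) = (\<theta> z * cnj (\<theta> z)) * cnj (s z)"
        using z by (simp add: theta0_eq shift_def mul_theta_def s_def)
      also have "\<theta> z * cnj (\<theta> z) = complex_of_real ((cmod (theta0 z))\<^sup>2 - 1) + disc_power 0 z"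
        using z by (simp add: complex_norm_square theta0_eq disc_power_def del: of_real_power)
      finally show ?case by (simp add: z_def algebra_simps)
    qed
    then have "(LINT \<zeta>|circle_measure. theta0 (of_real r * \<zeta>) * cnj (shift (mul_theta h) (of_real r * \<zeta>)))
        = (LINT \<zeta>|circle_measure. ?u \<zeta> * cnj (?s \<zeta>) + ?one \<zeta> * cnj (?s \<zeta>))"
      by (intro integral_cong_AE) auto
    also have "\<dots> = (LINT \<zeta>|circle_measure. ?u \<zeta> * cnj (?s \<zeta>)) + (LINT \<zeta>|circle_measure. ?one \<zeta> * cnj (?s \<zeta>))"
      by (intro Bochner_Integration.integral_add integrable_mult_cnj ui si oi) auto
    also have "\<dots> = (LINT \<zeta>|circle_measure. ?u \<zeta> * cnj (?s \<zeta>))" by (simp add: zero)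
    also have "norm \<dots> \<le> sqrt (LINT \<zeta>|circle_measure. (cmod (?u \<zeta>))\<^sup>2) * sqrt (LINT \<zeta>|circle_measure. (cmod (?s \<zeta>))\<^sup>2)"
      by (intro cmod_integral_mult_cnj ui si) auto
    also have "(LINT \<zeta>|circle_measure. (cmod (?u \<zeta>))\<^sup>2)
        = (LINT \<zeta>|circle_measure. ((cmod (theta0 (of_real r * \<zeta>)))\<^sup>2 - 1)\<^sup>2)"
      by (simp only: norm_of_real power2_abs)
    also have "sqrt \<dots> * sqrt (LINT \<zeta>|circle_measure. (cmod (?s \<zeta>))\<^sup>2) \<le> e r * K"
      unfolding e_def K_def
      by (intro mult_left_mono real_sqrt_le_mono integral_dilate_sq_le dh r hardy2_taylor s) auto
    finally show ?thesis .
  qed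
  have "((\<lambda>r. e r * K) \<longlongrightarrow> 0) (at_left 1)"
    unfolding e_def by (rule tendsto_eq_intros tendsto_modulus_defect refl | simp)+
  then show "((\<lambda>r. LINT \<zeta>|circle_measure. theta0 (of_real r * \<zeta>) * cnj (shift (mul_theta h) (of_real r * \<zeta>)))
      \<longlongrightarrow> 0) (at_left 1)"
    by (rule Lim_null_comparison[rotated]) (intro eventually_at_left_1 bound)
qed simp

end

section \<open>Model spaces\<close>

context inner_symbol
begin

abbreviation "K \<equiv> model_space \<theta>"

lemma model_space_iff: "f \<in> K \<longleftrightarrow> f \<in> hardy2 \<and> (\<forall>h\<in>hardy2. h2_inner f (mul_theta h) = 0)"
  by (simp add: model_space_def mul_theta_def)

lemma mul_theta_shift: "mul_theta (shift h) = shift (mul_theta h)"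
  by (auto simp: mul_theta_def shift_def)

lemma mul_theta_decompose:
  assumes "h \<in> hardy2"
  shows "mul_theta h = cscale (h 0) theta0 + shift (mul_theta (backward_shift h))"
proof
  fix z
  have "h z = h 0 * disc_power 0 z + z * backward_shift h z"
    using fun_cong[OF hardy2_decompose[OF assms], of z] by (simp only: plus_fun_apply cscale_def shift_def)
  then have "\<theta> z * h z = \<theta> z * (h 0 * disc_power 0 z + z * backward_shift h z)" by (simp only:)
  then show "mul_theta h z = (cscale (h 0) theta0 + shift (mul_theta (backward_shift h))) z"
    by (simp only: plus_fun_apply mul_theta_def theta0_def cscale_def shift_def distrib_left mult_ac)
qed

lemma h2_inner_mul_theta_decompose:
  assumes "f \<in> hardy2" "h \<in> hardy2"
  shows "h2_inner f (mul_theta h) = cnj (h 0) * h2_inner f theta0 + h2_inner f (shift (mul_theta (backward_shift h)))"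
  by (subst mul_theta_decompose[OF assms(2)])
     (simp add: h2_inner_add_right h2_inner_cscale_right hardy2_cscale hardy2_shift hardy2_mul_theta
        hardy2_backward_shift hardy2_theta0 assms)

text \<open>The adjoint turns a pairing with \<open>\<theta> h\<close> into one with \<open>\<theta> (z h)\<close>.\<close>

lemma backward_shift_in_model_space:
  assumes "k \<in> K" shows "backward_shift k \<in> K"
  using assms
  by (auto simp: model_space_iff hardy2_backward_shift h2_inner_backward_shift hardy2_mul_theta hardy2_shift
      simp flip: mul_theta_shift)

lemma backward_shift_theta_in_model_space: "backward_shift theta0 \<in> K"
  by (auto simp: model_space_iff hardy2_theta0 hardy2_backward_shift h2_inner_backward_shift hardy2_mul_theta
      theta_orthogonal_shift)

lemma theta0_neq_0: "theta0 \<noteq> 0"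
proof -
  obtain a where "a \<in> unit_disc" "\<theta> a \<noteq> 0" by (rule theta0_nonzero)
  then show ?thesis by (metis theta0_eq zero_fun_apply)
qed

text \<open>Every function in the range of multiplication by \<open>\<theta>\<close> splits as \<open>\<theta> h = h(0) \<theta> + z \<theta> h'\<close>, where
  \<open>h'\<close> is the backward shift of \<open>h\<close>. Both \<open>z k\<close> and \<open>\<theta>\<close> are orthogonal to the second
  part, so \<open>z k\<close> becomes orthogonal to the whole range once its projection onto \<open>\<theta>\<close> is removed.\<close>

lemma shift_model_space:
  assumes k: "k \<in> K" obtains c where "shift k - cscale c theta0 \<in> K"
proof
  define c where "c = h2_inner (shift k) theta0 / h2_inner theta0 theta0"
  have kh: "k \<in> hardy2" using k by (simp add: model_space_iff)
  have nz: "h2_inner theta0 theta0 \<noteq> 0"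
    using h2_inner_self_eq_0[OF hardy2_theta0] theta0_neq_0 by blast
  have "h2_inner (shift k - cscale c theta0) (mul_theta h) = 0" if h: "h \<in> hardy2" for h
  proof -
    have "h2_inner (shift k) (mul_theta h) = cnj (h 0) * h2_inner (shift k) theta0"
      using k h by (simp add: h2_inner_mul_theta_decompose hardy2_shift kh h2_inner_shift_shift hardy2_mul_theta
          hardy2_backward_shift model_space_iff)
    moreover have "h2_inner theta0 (mul_theta h) = cnj (h 0) * h2_inner theta0 theta0"
      using h by (simp add: h2_inner_mul_theta_decompose hardy2_theta0 theta_orthogonal_shift hardy2_backward_shift)
    ultimately show ?thesis
      using nz h by (simp add: h2_inner_diff_left h2_inner_cscale_left hardy2_shift kh hardy2_cscale
          hardy2_theta0 hardy2_mul_theta c_def)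
  qed
  then show "shift k - cscale c theta0 \<in> K"
    by (simp add: model_space_iff hardy2_diff hardy2_shift kh hardy2_cscale hardy2_theta0)
qed

text \<open>An element of both \<open>K\<close> and \<open>\<theta> H\<^sup>2\<close> is orthogonal to itself.\<close>

lemma model_space_multiple_eq_0:
  assumes "mul_theta h \<in> K" "h \<in> hardy2" shows "mul_theta h = 0"
  using assms by (intro h2_inner_self_eq_0) (auto simp: model_space_iff)

text \<open>The inner product of \<open>z\<^sup>n\<close> with \<open>\<theta>\<close> is the conjugate of a Taylor coefficient of \<open>\<theta>\<close>, and these do not all
  vanish.\<close>

lemma ex_disc_power_notin_model_space: "\<exists>n. disc_power n \<notin> K"
proof (rule ccontr)
  assume "\<not> ?thesis"
  then have "h2_inner (disc_power n) theta0 = 0" for n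
    by (auto simp: model_space_iff theta0_def hardy2_disc_power)
  moreover have "h2_inner (disc_power n) theta0 = cnj (taylor_coeff theta0 n)" for n
  proof -
    have "(\<lambda>m. taylor_coeff (disc_power n) m * cnj (taylor_coeff theta0 m))
        = (\<lambda>m. if m = n then cnj (taylor_coeff theta0 m) else 0)"
      by (auto simp: taylor_coeff_disc_power)
    then show ?thesis
      using sums_unique[OF sums_single[of n "\<lambda>m. cnj (taylor_coeff theta0 m)"]]
      by (simp add: h2_inner_eq hardy2_disc_power hardy2_theta0)
  qed
  ultimately have "taylor_coeff theta0 n = 0" for n by simp
  then have "h2_inner theta0 theta0 = 0" by (simp add: h2_inner_eq hardy2_theta0)
  then show False using h2_inner_self_eq_0[OF hardy2_theta0] theta0_neq_0 by blast
qed

end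

section \<open>Finite-dimensional function spaces\<close>

lemma hardy2_sum_disc_power: "(\<Sum>n\<le>N. cscale (c n) (disc_power n)) \<in> hardy2"
  by (intro cfun.subspace_sum subspace_hardy2 hardy2_cscale hardy2_disc_power)

lemma sum_cscale_apply: "(\<Sum>n\<in>A. cscale (c n) (v n)) z = (\<Sum>n\<in>A. c n * v n z)"
  by (induction A rule: infinite_finite_induct) (auto simp: cscale_def)

text \<open>Dependence of a sequence rather than of a set: if \<open>v\<close> takes a value twice, the two indices give the
  relation; otherwise the first \<open>card B + 1\<close> values exceed the size of a spanning set \<open>B\<close>.\<close>

lemma finite_dimensional_dependent:
  assumes "finite_dimensional F" "\<And>n. v n \<in> F"
  obtains N :: nat and c where "\<exists>n\<le>N. c n \<noteq> 0" "(\<Sum>n\<le>N. cscale (c n) (v n)) = 0"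
proof -
  obtain B where B: "finite B" "F = cfun.span B" using assms(1) by (auto simp: finite_dimensional_def)
  define N where "N = card B"
  have "\<exists>c. (\<exists>n\<le>N. c n \<noteq> 0) \<and> (\<Sum>n\<le>N. cscale (c n) (v n)) = 0"
  proof (cases "inj_on v {..N}")
    case True
    have "cfun.dependent (v ` {..N})"
    proof (rule ccontr)
      assume "\<not> ?thesis"
      then have "card (v ` {..N}) \<le> card B"
        using cfun.independent_span_bound[OF B(1), of "v ` {..N}"] assms(2) B(2) by blast
      then show False using card_image[OF True] by (simp add: N_def)
    qed
    then obtain u where u: "\<exists>x\<in>v ` {..N}. u x \<noteq> 0" "(\<Sum>x\<in>v ` {..N}. cscale (u x) x) = 0"
      using cfun.dependent_finite[of "v ` {..N}"] by auto
    have "(\<Sum>n\<le>N. cscale (u (v n)) (v n)) = 0"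
      using u(2) sum.reindex[OF True, of "\<lambda>x. cscale (u x) x"] by (simp add: o_def)
    then show ?thesis using u(1) by (intro exI[of _ "\<lambda>n. u (v n)"]) auto
  next
    case False
    then obtain i j where ij: "i \<le> N" "j \<le> N" "i \<noteq> j" "v i = v j" by (auto simp: inj_on_def)
    define c :: "nat \<Rightarrow> complex" where "c n = (if n = i then 1 else 0) - (if n = j then 1 else 0)" for n
    have "(\<Sum>n\<le>N. cscale (c n) (v n)) z = 0" for z
      using ij by (simp add: sum_cscale_apply c_def left_diff_distrib sum_subtractf if_distrib[of "\<lambda>x. x * _"] cong: if_cong)
    moreover have "c i \<noteq> 0" using ij by (simp add: c_def)
    ultimately show ?thesis using ij(1) by (intro exI[of _ c]) (auto simp: fun_eq_iff)
  qed
  then show ?thesis using that by blast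
qed

lemma finite_dimensional_dim_0:
  assumes "finite_dimensional F" "cfun.dim F = 0" shows "F \<subseteq> {0}"
proof -
  obtain B where B: "finite B" "F = cfun.span B" using assms(1) by (auto simp: finite_dimensional_def)
  obtain C where C: "C \<subseteq> F" "cfun.independent C" "F \<subseteq> cfun.span C" "card C = cfun.dim F"
    by (rule cfun.basis_exists)
  have "finite C" using cfun.independent_span_bound[OF B(1) C(2)] C(1) B(2) by blast
  then have "C = {}" using C(4) assms(2) by simp
  then show ?thesis using C(3) by simp
qed

lemma dim_span_singleton: "\<phi> \<noteq> 0 \<Longrightarrow> cfun.dim (cfun.span {\<phi>}) = 1"
  by (subst cfun.dim_span_eq_card_independent) auto

lemma taylor_coeff_0: "taylor_coeff 0 n = 0"
  using taylor_coeff_cscale[OF zero_in_hardy2, of 0] by (simp add: cscale_def zero_fun_def)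

text \<open>Closedness: convergence in norm implies convergence of every Taylor coefficient, and one non-zero
  coefficient of \<open>\<phi>\<close> forces the scalars to converge.\<close>

lemma h2_subspace_span_singleton:
  assumes \<phi>: "\<phi> \<in> hardy2" "\<phi> \<noteq> 0"
  shows "h2_subspace (cfun.span {\<phi>})"
  unfolding h2_subspace_def
proof (intro conjI allI impI)
  show "cfun.span {\<phi>} \<subseteq> hardy2"
    using \<phi> by (intro cfun.span_minimal subspace_hardy2) auto
  show "cfun.subspace (cfun.span {\<phi>})" by simp
  fix u f assume u: "(\<forall>n. u n \<in> cfun.span {\<phi>}) \<and> f \<in> hardy2 \<and> (\<lambda>n. h2_norm (u n - f)) \<longlonglongrightarrow> 0"
  then have f: "f \<in> hardy2" by blast
  have "\<forall>n. \<exists>c. u n = cscale c \<phi>" using u by (auto simp: cfun.span_singleton)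
  then obtain c where c: "\<And>n. u n = cscale (c n) \<phi>" by metis
  have lim: "(\<lambda>n. c n * taylor_coeff \<phi> k) \<longlonglongrightarrow> taylor_coeff f k" for k
  proof -
    have "cmod (c n * taylor_coeff \<phi> k - taylor_coeff f k) \<le> h2_norm (u n - f)" for n
      using cmod_taylor_coeff_le_h2_norm[of "u n - f" k] \<phi> f
      by (simp add: c hardy2_diff hardy2_cscale taylor_coeff_diff taylor_coeff_cscale)
    then have "\<forall>\<^sub>F n in sequentially. norm (c n * taylor_coeff \<phi> k - taylor_coeff f k) \<le> h2_norm (u n - f)"
      by (intro always_eventually allI)
    then have "(\<lambda>n. c n * taylor_coeff \<phi> k - taylor_coeff f k) \<longlonglongrightarrow> 0"
      by (rule Lim_null_comparison) (rule u[THEN conjunct2, THEN conjunct2])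
    then show ?thesis by (rule LIM_zero_cancel)
  qed
  obtain k where k: "taylor_coeff \<phi> k \<noteq> 0"
    using hardy2_ext[OF \<phi>(1) zero_in_hardy2] \<phi>(2) by (auto simp: taylor_coeff_0)
  define c0 where "c0 = taylor_coeff f k / taylor_coeff \<phi> k"
  have "c \<longlonglongrightarrow> c0"
    using tendsto_divide[OF lim[of k] tendsto_const k] k by (simp add: c0_def)
  then have "taylor_coeff f j = c0 * taylor_coeff \<phi> j" for j
    by (rule LIMSEQ_unique[OF lim tendsto_mult_right])
  then have "f = cscale c0 \<phi>"
    using \<phi> f by (intro hardy2_ext) (auto simp: hardy2_cscale taylor_coeff_cscale)
  then show "f \<in> cfun.span {\<phi>}" by (auto simp: cfun.span_singleton)
qed

section \<open>Cancellation and rationality\<close>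

lemma hardy2_holomorphic: "f \<in> hardy2 \<Longrightarrow> f holomorphic_on unit_disc"
  by (simp add: hardy2_def)

text \<open>The set where \<open>g\<close> does not vanish is open and non-empty, so the identity theorem applies.\<close>

lemma holomorphic_cancel:
  assumes g: "g holomorphic_on unit_disc" and a: "a \<in> unit_disc" "g a \<noteq> 0"
    and f: "f1 holomorphic_on unit_disc" "f2 holomorphic_on unit_disc"
    and eq: "\<And>z. z \<in> unit_disc \<Longrightarrow> g z * f1 z = g z * f2 z"
    and z: "z \<in> unit_disc"
  shows "f1 z = f2 z"
proof (rule analytic_continuation_open[where f = f1 and g = f2 and s = "unit_disc \<inter> g -` (-{0})" and s' = unit_disc])
  show "open (unit_disc \<inter> g -` (-{0}))"
    by (rule continuous_open_preimage[OF holomorphic_on_imp_continuous_on[OF g]]) auto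
  show "f1 w = f2 w" if "w \<in> unit_disc \<inter> g -` (-{0})" for w
    using eq[of w] that by auto
qed (use a f z in auto)

text \<open>The denominator \<open>q\<close> may vanish in the disc. A zero of \<open>q\<close> there is a zero of \<open>p\<close>, so the corresponding
  linear factor cancels and the degree of \<open>q\<close> decreases.\<close>

lemma rational_if_poly_multiple:
  assumes \<theta>: "\<theta> holomorphic_on unit_disc"
  shows "q \<noteq> 0 \<Longrightarrow> (\<And>z. z \<in> unit_disc \<Longrightarrow> poly q z * \<theta> z = poly p z) \<Longrightarrow> rational_on_disc \<theta>"
proof (induction "degree q" arbitrary: p q rule: less_induct)
  case less
  show ?case
  proof (cases "\<exists>a\<in>unit_disc. poly q a = 0")
    case False
    then have "poly q z \<noteq> 0 \<and> \<theta> z = poly p z / poly q z" if "z \<in> unit_disc" for z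
      using less.prems(2)[OF that] that by (auto simp: eq_divide_eq mult.commute)
    then show ?thesis unfolding rational_on_disc_def by blast
  next
    case True
    then obtain a where a: "a \<in> unit_disc" "poly q a = 0" by blast
    then have "poly p a = 0" using less.prems(2)[of a] by simp
    then have "[:-a, 1:] dvd q" "[:-a, 1:] dvd p" using a by (simp_all only: poly_eq_0_iff_dvd)
    then obtain q' p' where q': "q = [:-a, 1:] * q'" and p': "p = [:-a, 1:] * p'"
      unfolding dvd_def by blast
    have q0: "q' \<noteq> 0" using less.prems(1) q' by auto
    have "degree q = Suc (degree q')" using q0 unfolding q' by (subst degree_mult_eq) auto
    moreover have "poly q' z * \<theta> z = poly p' z" if z: "z \<in> unit_disc" for z
    proof (rule holomorphic_cancel[where ?f1.0 = "\<lambda>z. poly q' z * \<theta> z" and ?f2.0 = "poly p'"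
          (* some point of the disc other than the zero of z - a *)
          and g = "\<lambda>z. z - a" and a = "if a = 0 then 1/2 else 0"])
      show "(w - a) * (poly q' w * \<theta> w) = (w - a) * poly p' w" if "w \<in> unit_disc" for w
        using less.prems(2)[OF that] by (simp add: q' p' algebra_simps)
    qed (use z \<theta> in \<open>auto intro!: holomorphic_intros\<close>)
    ultimately show ?thesis using less.hyps[of q' p'] q0 by simp
  qed
qed

section \<open>Linear dependence of iterated backward shifts\<close>

context inner_symbol
begin

text \<open>Each backward shift removes one term of the Taylor expansion and divides by \<open>z\<close>.\<close>

lemma iterated_backward_shift_theta:
  "\<exists>p. \<forall>z\<in>unit_disc. z ^ n * (backward_shift ^^ n) theta0 z = \<theta> z - poly p z"
proof (induction n)
  case 0
  show ?case by (rule exI[of _ 0]) (auto simp: theta0_eq)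
next
  case (Suc n)
  define v where "v = (backward_shift ^^ n) theta0"
  obtain p where p: "\<And>z. z \<in> unit_disc \<Longrightarrow> z ^ n * v z = \<theta> z - poly p z"
    using Suc by (auto simp: v_def)
  have "z ^ Suc n * backward_shift v z = \<theta> z - poly (p + monom (v 0) n) z" if "z \<in> unit_disc" for z
  proof -
    have "z * backward_shift v z = v z - v 0"
      using that by (simp add: backward_shift_def)
    then have "z ^ Suc n * backward_shift v z = z ^ n * v z - z ^ n * v 0"
      by (simp only: power_Suc2 mult.assoc right_diff_distrib)
    then show ?thesis using p[OF that] by (simp add: poly_monom algebra_simps)
  qed
  then show ?case
    by (intro exI[of _ "p + monom (v 0) n"] ballI) (simp only: v_def funpow.simps o_apply)
qed

lemma iterated_backward_shift_theta_in_model_space: "(backward_shift ^^ Suc n) theta0 \<in> K"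
  by (induction n) (auto simp: backward_shift_theta_in_model_space backward_shift_in_model_space)

text \<open>Multiplying a relation between the first \<open>N + 1\<close> iterates by \<open>z\<^bsup>N + 1\<^esup>\<close> turns every iterate into \<open>\<theta>\<close> minus a
  polynomial, times a power of \<open>z\<close>. Different iterates carry different powers, so the polynomial
  that multiplies \<open>\<theta>\<close> is not zero.\<close>

lemma rational_if_dependent:
  assumes nz: "\<exists>n\<le>N. c n \<noteq> 0"
    and dep: "\<And>z. z \<in> unit_disc \<Longrightarrow> (\<Sum>n\<le>N. c n * (backward_shift ^^ Suc n) theta0 z) = 0"
  shows "rational_on_disc \<theta>"
proof -
  have "\<exists>P. \<forall>n. \<forall>z\<in>unit_disc. z ^ n * (backward_shift ^^ n) theta0 z = \<theta> z - poly (P n) z"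
    by (intro choice allI iterated_backward_shift_theta)
  then obtain P where P: "\<And>n z. z \<in> unit_disc \<Longrightarrow> z ^ n * (backward_shift ^^ n) theta0 z = \<theta> z - poly (P n) z"
    by blast
  define q where "q = (\<Sum>n\<le>N. monom (c n) (N - n))"
  define p where "p = (\<Sum>n\<le>N. monom (c n) (N - n) * P (Suc n))"
  obtain m where m: "m \<le> N" "c m \<noteq> 0" using nz by blast
  have "coeff q (N - m) = (\<Sum>n\<le>N. if n = m then c n else 0)"
    unfolding q_def coeff_sum by (intro sum.cong) (use m in auto)
  then have "q \<noteq> 0" using m by auto
  moreover have "poly q z * \<theta> z = poly p z" if z: "z \<in> unit_disc" for z
  proof -
    have "poly q z * \<theta> z - poly p z = (\<Sum>n\<le>N. c n * z ^ (N - n) * (\<theta> z - poly (P (Suc n)) z))"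
      by (simp only: q_def p_def poly_sum poly_mult poly_monom sum_distrib_right sum_subtractf[symmetric]
          right_diff_distrib)
    also have "\<dots> = (\<Sum>n\<le>N. z ^ Suc N * (c n * (backward_shift ^^ Suc n) theta0 z))"
    proof (intro sum.cong refl)
      fix n assume "n \<in> {..N}"
      then have "z ^ Suc N = z ^ (N - n) * z ^ Suc n" by (simp flip: power_add)
      then show "c n * z ^ (N - n) * (\<theta> z - poly (P (Suc n)) z)
          = z ^ Suc N * (c n * (backward_shift ^^ Suc n) theta0 z)"
        unfolding P[OF z, symmetric] by (simp only: mult_ac)
    qed
    also have "\<dots> = z ^ Suc N * (\<Sum>n\<le>N. c n * (backward_shift ^^ Suc n) theta0 z)"
      by (simp only: sum_distrib_left)
    also have "\<dots> = 0" by (simp only: dep[OF z] mult_zero_right)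
    finally show ?thesis by simp
  qed
  ultimately show ?thesis using rational_if_poly_multiple[OF holo_theta] by blast
qed

end

section \<open>The subspace of multiples of a model space\<close>

text \<open>The value of \<open>g\<close> at the origin makes \<open>g\<close> a non-zero holomorphic function, by which equations on the disc
  may be divided: \<open>M\<close> and the model space correspond bijectively.\<close>

locale multiplied_model_space = inner_symbol +
  fixes g :: "complex \<Rightarrow> complex" and M :: "(complex \<Rightarrow> complex) set"
  assumes subspace_M: "h2_subspace M"
    and M_eq: "M = (\<lambda>k z. g z * k z) ` K"
    and g_in_M: "g \<in> M"
    and g_0: "g 0 \<noteq> 0"
begin

lemma M_subset_hardy2: "M \<subseteq> hardy2"
  using subspace_M by (simp add: h2_subspace_def)

lemma g_hardy2: "g \<in> hardy2"
  using g_in_M M_subset_hardy2 by blast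

lemma cancel_g:
  assumes f: "f1 \<in> hardy2" "f2 \<in> hardy2" and eq: "\<And>z. z \<in> unit_disc \<Longrightarrow> g z * f1 z = g z * f2 z"
  shows "f1 = f2"
proof
  fix z
  show "f1 z = f2 z"
  proof (cases "z \<in> unit_disc")
    case True
    then show ?thesis
      by (intro holomorphic_cancel[of g 0 f1 f2] hardy2_holomorphic g_hardy2 f eq) (auto simp: g_0)
  next
    case False
    then show ?thesis using f by (simp add: hardy2_taylor)
  qed
qed

lemma g_times_in_M_iff:
  assumes "f \<in> hardy2" shows "(\<lambda>z. g z * f z) \<in> M \<longleftrightarrow> f \<in> K"
proof
  assume "(\<lambda>z. g z * f z) \<in> M"
  then obtain k where k: "k \<in> K" "(\<lambda>z. g z * f z) = (\<lambda>z. g z * k z)" by (auto simp: M_eq)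
  have "f = k"
    using k by (intro cancel_g assms) (auto simp: model_space_iff fun_eq_iff)
  then show "f \<in> K" using k by simp
qed (auto simp: M_eq)

lemma mul_theta_g_neq_0: "mul_theta g \<noteq> 0"
proof
  assume 0: "mul_theta g = 0"
  have "theta0 = 0"
  proof (rule cancel_g)
    fix z assume "z \<in> unit_disc"
    then show "g z * theta0 z = g z * 0 z"
      using fun_cong[OF 0, of z] by (auto simp: mul_theta_def theta0_eq)
  qed (simp_all add: hardy2_theta0 zero_in_hardy2)
  then show False using theta0_neq_0 by simp
qed

text \<open>This is the decomposition of the shifted model space, multiplied by \<open>g\<close>.\<close>

lemma shift_M: "shift ` M \<subseteq> sum_space M (cfun.span {mul_theta g})"
proof
  fix f assume "f \<in> shift ` M"
  then obtain k where k: "k \<in> K" "f = shift (\<lambda>z. g z * k z)" by (auto simp: M_eq)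
  obtain c where c: "shift k - cscale c theta0 \<in> K" by (rule shift_model_space[OF k(1)])
  have "f z = ((\<lambda>z. g z * (shift k - cscale c theta0) z) + cscale c (mul_theta g)) z" for z
  proof (cases "z \<in> unit_disc")
    case True
    then show ?thesis by (simp add: k shift_def cscale_def mul_theta_def theta0_eq algebra_simps)
  next
    case False
    then show ?thesis using g_hardy2 by (simp add: k shift_def cscale_def mul_theta_def hardy2_taylor)
  qed
  then have "f = (\<lambda>z. g z * (shift k - cscale c theta0) z) + cscale c (mul_theta g)" by blast
  moreover have "(\<lambda>z. g z * (shift k - cscale c theta0) z) \<in> M"
    unfolding M_eq using c by (rule imageI)
  moreover have "cscale c (mul_theta g) \<in> cfun.span {mul_theta g}"
    by (intro cfun.span_scale cfun.span_base) simp
  ultimately show "f \<in> sum_space M (cfun.span {mul_theta g})"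
    unfolding sum_space_def by blast
qed

lemma almost_invariant_via_span: "almost_invariant_via shift M (cfun.span {mul_theta g})"
  unfolding almost_invariant_via_def finite_dimensional_def
  using h2_subspace_span_singleton[OF hardy2_mul_theta[OF g_hardy2] mul_theta_g_neq_0] shift_M by blast

text \<open>Since \<open>g\<close> itself lies in \<open>M\<close>, an invariant \<open>M\<close> would contain \<open>g z\<^sup>n\<close> for all \<open>n\<close>, and the model space
  would contain all monomials.\<close>

lemma not_shift_invariant: "\<not> shift ` M \<subseteq> M"
proof
  assume inv: "shift ` M \<subseteq> M"
  have "(\<lambda>z. g z * disc_power n z) \<in> M" for n
  proof (induction n)
    case 0
    have "(\<lambda>z. g z * disc_power 0 z) = g"
      using hardy2_taylor(1)[OF g_hardy2] by (auto simp: fun_eq_iff disc_power_def)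
    then show ?case using g_in_M by simp
  next
    case (Suc n)
    have "shift (\<lambda>z. g z * disc_power n z) = (\<lambda>z. g z * disc_power (Suc n) z)"
      by (auto simp: shift_def disc_power_def)
    then show ?case using Suc inv by auto
  qed
  then show False
    using ex_disc_power_notin_model_space g_times_in_M_iff hardy2_disc_power by blast
qed

lemma defect_M: "defect shift M = 1"
  unfolding defect_def
proof (rule Least_equality)
  show "\<exists>F. almost_invariant_via shift M F \<and> cfun.dim F = 1"
    using almost_invariant_via_span dim_span_singleton[OF mul_theta_g_neq_0] by blast
next
  fix n assume "\<exists>F. almost_invariant_via shift M F \<and> cfun.dim F = n"
  then obtain F where F: "almost_invariant_via shift M F" "cfun.dim F = n" by blast
  show "1 \<le> n"
  proof (rule ccontr)
    assume "\<not> 1 \<le> n"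
    then have "F \<subseteq> {0}" using F finite_dimensional_dim_0 by (simp add: almost_invariant_via_def)
    then have "sum_space M F \<subseteq> M" unfolding sum_space_def by auto
    then show False using F(1) not_shift_invariant by (auto simp: almost_invariant_via_def)
  qed
qed

text \<open>The functions \<open>g \<theta> z\<^sup>n\<close> are linearly independent modulo \<open>M\<close>: if \<open>g \<theta> p = g k\<close> for a polynomial \<open>p\<close> and an
  element \<open>k\<close> of the model space, then \<open>k = \<theta> p\<close> is orthogonal to itself. If \<open>M + F\<close> were
  everything with \<open>F\<close> of finite dimension, the components of these functions in \<open>F\<close> would be linearly
  dependent, and a non-trivial combination of them would fall into \<open>M\<close>.\<close>

lemma infinite_codimension:
  assumes fd: "finite_dimensional F" and eq: "sum_space M F = hardy2"
  shows False
proof -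
  define w where "w n = (\<lambda>z. g z * mul_theta (disc_power n) z)" for n
  have w: "w n \<in> hardy2" for n
  proof -
    have "w n = (shift ^^ n) (mul_theta g)"
    proof (induction n)
      case 0
      show ?case using hardy2_taylor(1)[OF g_hardy2]
        by (auto simp: w_def mul_theta_def disc_power_def fun_eq_iff)
    next
      case (Suc n)
      have "w (Suc n) = shift (w n)"
        by (auto simp: w_def mul_theta_def disc_power_def shift_def)
      then show ?case by (simp add: Suc)
    qed
    moreover have "(shift ^^ n) (mul_theta g) \<in> hardy2"
      by (induction n) (auto simp: hardy2_mul_theta g_hardy2 hardy2_shift)
    ultimately show ?thesis by simp
  qed
  have "\<exists>m f. m \<in> M \<and> f \<in> F \<and> w n = m + f" for n
    using w[of n] eq unfolding sum_space_def by blast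
  then obtain m f where mf: "\<And>n. m n \<in> M" "\<And>n. f n \<in> F" "\<And>n. w n = m n + f n" by metis
  obtain N c where c: "\<exists>n\<le>N. c n \<noteq> 0" "(\<Sum>n\<le>N. cscale (c n) (f n)) = 0"
    by (rule finite_dimensional_dependent[where v = f, OF fd mf(2)])
  define p where "p = (\<Sum>n\<le>N. cscale (c n) (disc_power n))"
  have p: "p \<in> hardy2" unfolding p_def by (rule hardy2_sum_disc_power)
  have "(\<lambda>z. g z * mul_theta p z) = (\<Sum>n\<le>N. cscale (c n) (m n))"
  proof
    fix z
    have "g z * mul_theta p z = (\<Sum>n\<le>N. c n * w n z)"
      by (simp add: mul_theta_def p_def sum_cscale_apply w_def sum_distrib_left mult_ac)
    also have "\<dots> = (\<Sum>n\<le>N. cscale (c n) (m n)) z + (\<Sum>n\<le>N. cscale (c n) (f n)) z"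
      by (simp add: mf(3) sum_cscale_apply distrib_left sum.distrib)
    finally show "g z * mul_theta p z = (\<Sum>n\<le>N. cscale (c n) (m n)) z" by (simp add: c(2))
  qed
  also have "\<dots> \<in> M"
    using subspace_M mf(1) by (intro cfun.subspace_sum cfun.subspace_scale) (auto simp: h2_subspace_def)
  finally have "mul_theta p \<in> K" using g_times_in_M_iff[OF hardy2_mul_theta[OF p]] by simp
  then have 0: "mul_theta p = 0" by (rule model_space_multiple_eq_0[OF _ p])
  have p0: "p z = 0" if "z \<in> unit_disc" for z
  proof -
    obtain a where a: "a \<in> unit_disc" "\<theta> a \<noteq> 0" by (rule theta0_nonzero)
    show ?thesis
    proof (rule holomorphic_cancel[OF holo_theta a, of p "\<lambda>_. 0", OF _ _ _ that])
      show "\<theta> z * p z = \<theta> z * 0" for z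
        using fun_cong[OF 0, of z] by (simp add: mul_theta_def)
    qed (auto intro: hardy2_holomorphic p)
  qed
  have "c n = 0" if "n \<le> N" for n
  proof -
    define a where "a i = (if i \<le> N then c i else 0)" for i
    have "(\<lambda>i. a i * z ^ i) sums p z" if z: "z \<in> unit_disc" for z
    proof -
      have "(\<lambda>i. a i * z ^ i) sums (\<Sum>i\<le>N. a i * z ^ i)"
        by (rule sums_finite) (auto simp: a_def)
      also have "(\<Sum>i\<le>N. a i * z ^ i) = p z"
        unfolding p_def sum_cscale_apply using z by (intro sum.cong) (auto simp: a_def disc_power_def)
      finally show ?thesis .
    qed
    from taylor_coeff_eqI[OF this] have "taylor_coeff p = a" .
    moreover have "taylor_coeff p = (\<lambda>_. 0)"
      by (rule taylor_coeff_eqI) (simp add: p0)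
    ultimately have "a n = 0" by (metis (full_types))
    then show ?thesis using that by (simp add: a_def)
  qed
  then show False using c(1) by blast
qed

text \<open>The iterated backward shifts of \<open>\<theta>\<close> belong to the model space, so their multiples by \<open>g\<close> form a sequence in
  \<open>M\<close>. A relation between these multiples is one between the iterates.\<close>

lemma rational_if_finite_dimensional:
  assumes "finite_dimensional M"
  shows "rational_on_disc \<theta>"
proof -
  define v where "v n = (backward_shift ^^ Suc n) theta0" for n
  have v: "v n \<in> K" for n unfolding v_def by (rule iterated_backward_shift_theta_in_model_space)
  then have vh: "v n \<in> hardy2" for n by (simp add: model_space_iff)
  have "(\<lambda>z. g z * v n z) \<in> M" for n using v by (auto simp: M_eq)
  then obtain N c where c: "\<exists>n\<le>N. c n \<noteq> 0" "(\<Sum>n\<le>N. cscale (c n) (\<lambda>z. g z * v n z)) = 0"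
    by (rule finite_dimensional_dependent[where v = "\<lambda>n z. g z * v n z", OF assms])
  have "(\<Sum>n\<le>N. cscale (c n) (v n)) = 0"
  proof (rule cancel_g)
    show "(\<Sum>n\<le>N. cscale (c n) (v n)) \<in> hardy2"
      by (intro cfun.subspace_sum subspace_hardy2 hardy2_cscale vh)
    show "g z * (\<Sum>n\<le>N. cscale (c n) (v n)) z = g z * 0 z" for z
      using fun_cong[OF c(2), of z] by (simp add: sum_cscale_apply sum_distrib_left mult_ac)
  qed (rule zero_in_hardy2)
  from fun_cong[OF this] have "(\<Sum>n\<le>N. c n * v n z) = 0" for z
    by (simp add: sum_cscale_apply)
  then show ?thesis
    unfolding v_def by (rule rational_if_dependent[OF c(1)])
qed

end

theorem proposition2p2:
  fixes M :: "(complex \<Rightarrow> complex) set" and \<theta> g :: "complex \<Rightarrow> complex"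
  assumes "nearly_invariant M"
    and "M \<noteq> {0}" and "M \<noteq> hardy2"
    and "inner_function \<theta>"
    and "M = (\<lambda>k z. g z * k z) ` model_space \<theta>"
    and "g \<in> M" and "h2_norm g = 1"
    and "g 0 \<in> \<real>" and "Re (g 0) > 0"
    and "\<forall>f\<in>M. f 0 = 0 \<longrightarrow> h2_inner g f = 0"
    and "\<forall>k\<in>model_space \<theta>. (\<lambda>z. g z * k z) \<in> hardy2 \<and> h2_norm (\<lambda>z. g z * k z) = h2_norm k"
  shows "almost_invariant shift M \<and> defect shift M = 1 \<and>
    (\<not> rational_on_disc \<theta> \<longrightarrow>
       half_space M \<and> almost_invariant shift M \<and> defect shift M = 1)"
proof -
  interpret multiplied_model_space \<theta> g M
    using assms by unfold_locales (auto simp: nearly_invariant_def)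
  have ai: "almost_invariant shift M"
    using subspace_M almost_invariant_via_span by (auto simp: almost_invariant_def)
  have "half_space M" if "\<not> rational_on_disc \<theta>"
    using that subspace_M rational_if_finite_dimensional infinite_codimension by (auto simp: half_space_def)
  then show ?thesis using ai defect_M by blast
qed

end
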